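(* Let $n\ge 3$ and let $m_1,m_2\ge 2$ be integers with $m_1\mid m_2$. Then $$M\big(\mathrm{UT}_n(\mathbb Z/m_1\mathbb Z\times\mathbb Z/m_2\mathbb Z)\big)\cong M(\mathrm{UT}_n(\mathbb Z/m_1\mathbb Z))\oplus M(\mathrm{UT}_n(\mathbb Z/m_2\mathbb Z))\oplus(\mathbb Z/m_1\mathbb Z)^{(n-1)^2}.$$
   Context: $\mathrm{UT}_n(A)$ is the group of upper unitriangular $n\times n$ matrices over a ring $A$, and $M(G)=H_2(G,\mathbb Z)$ is the Schur multiplier. *)

theory Defs
  imports "HOL-Algebra.Coset" "HOL-Algebra.Chinese_Remainder" "HOL-Algebra.Elementary_Groups"
    "HOL-Algebra.Product_Groups" "HOL-Number_Theory.Residues"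
begin

definition chains :: "('g, 'b) monoid_scheme \<Rightarrow> nat \<Rightarrow> ('g list \<Rightarrow> int) set" where
  "chains G k = {c. finite {x. c x \<noteq> 0} \<and>
                    (\<forall>x. c x \<noteq> 0 \<longrightarrow> length x = k \<and> set x \<subseteq> carrier G)}"

text \<open>Face maps of the bar complex with trivial coefficients:
  d_0 [g1..gk] = [g2..gk], d_i = [.., g_i g_(i+1), ..], d_k = [g1..g_(k-1)].\<close>
definition face :: "('g, 'b) monoid_scheme \<Rightarrow> nat \<Rightarrow> 'g list \<Rightarrow> 'g list" where
  "face G i x = (if i = 0 then tl x
                 else if i = length x then butlast x
                 else take (i - 1) x @ [x ! (i - 1) \<otimes>\<^bsub>G\<^esub> x ! i] @ drop (i + 1) x)"

definition bdry :: "('g, 'b) monoid_scheme \<Rightarrow> nat \<Rightarrow> ('g list \<Rightarrow> int) \<Rightarrow> ('g list \<Rightarrow> int)" where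
  "bdry G k c = (\<lambda>y. \<Sum>x\<in>{x. c x \<noteq> 0}. c x * (\<Sum>i\<le>k. if face G i x = y then (-1) ^ i else 0))"

definition cycles2 :: "('g, 'b) monoid_scheme \<Rightarrow> ('g list \<Rightarrow> int) set" where
  "cycles2 G = {c \<in> chains G 2. bdry G 2 c = (\<lambda>_. 0)}"

definition boundaries2 :: "('g, 'b) monoid_scheme \<Rightarrow> ('g list \<Rightarrow> int) set" where
  "boundaries2 G = bdry G 3 ` chains G 3"

definition cycles2_group :: "('g, 'b) monoid_scheme \<Rightarrow> ('g list \<Rightarrow> int) monoid" where
  "cycles2_group G = \<lparr>carrier = cycles2 G, monoid.mult = (\<lambda>a b. \<lambda>x. a x + b x), one = (\<lambda>_. 0)\<rparr>"

definition schur_multiplier :: "('g, 'b) monoid_scheme \<Rightarrow> ('g list \<Rightarrow> int) set monoid" where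
  "schur_multiplier G = cycles2_group G Mod boundaries2 G"

definition UT :: "nat \<Rightarrow> ('a, 'b) ring_scheme \<Rightarrow> (nat \<Rightarrow> nat \<Rightarrow> 'a) monoid" where
  "UT n R = \<lparr>carrier = {A. \<forall>i j.
                 (i < n \<and> j < n \<longrightarrow> A i j \<in> carrier R) \<and>
                 (i < n \<and> j < i \<longrightarrow> A i j = \<zero>\<^bsub>R\<^esub>) \<and>
                 (i < n \<longrightarrow> A i i = \<one>\<^bsub>R\<^esub>) \<and>
                 (\<not> (i < n \<and> j < n) \<longrightarrow> A i j = \<zero>\<^bsub>R\<^esub>)},
            monoid.mult = (\<lambda>A B i j. if i < n \<and> j < n
                               then finsum R (\<lambda>k. A i k \<otimes>\<^bsub>R\<^esub> B k j) {..<n}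
                               else \<zero>\<^bsub>R\<^esub>),
            one = (\<lambda>i j. if i < n \<and> j < n \<and> i = j then \<one>\<^bsub>R\<^esub> else \<zero>\<^bsub>R\<^esub>)\<rparr>"

end

theory Submission
  imports Defs "HOL-Library.Function_Algebras"
begin

text \<open>
  \<open>UT\<^sub>n\<close> of a product ring is the product \<open>G \<times> H\<close> of the two unitriangular groups, so this is the
  Kuenneth formula in degree 2. It is obtained on bar chains: modulo boundaries, every 2-cycle \<open>c\<close> of
  \<open>G \<times> H\<close> is the sum of its two projections and of \<open>\<Sum> c(x, y) \<chi>(h\<^sub>x, g\<^sub>y)\<close>, where
  \<open>\<chi>(h, g) = [h|g] - [g|h]\<close> is bilinear modulo boundaries. Hence \<open>\<chi>\<close> factors through the
  abelianizations, which are free modules over \<open>\<int>/m\<^sub>1\<close> and \<open>\<int>/m\<^sub>2\<close> with the superdiagonal entries as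
  coordinates. The corresponding coefficients of \<open>c\<close> modulo \<open>m\<^sub>1\<close> are detected by the bilinear cocycles
  \<open>(x, y) \<mapsto> \<beta>\<^sub>j(h\<^sub>x) \<alpha>\<^sub>i(g\<^sub>y)\<close>; they are well defined because \<open>m\<^sub>1\<close> divides \<open>m\<^sub>2\<close>.
\<close>

section \<open>Bar chains\<close>

lemma of_int_fun_apply [simp]: "(of_int k :: 'a \<Rightarrow> 'b::ring_1) x = of_int k"
  by (cases k) simp_all

lemma sum_fun_apply:
  fixes f :: "'i \<Rightarrow> 'a \<Rightarrow> 'b::comm_monoid_add"
  shows "(\<Sum>i\<in>A. f i) x = (\<Sum>i\<in>A. f i x)"
  by (induction A rule: infinite_finite_induct) simp_all

text \<open>Chains are functions into \<open>int\<close> and form a commutative ring under pointwise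
  operations. Subgroups are therefore taken in an arbitrary commutative ring, where the multiple of
  \<open>a\<close> by an integer \<open>k\<close> reads \<open>of_int k * a\<close>; the same lemmas
  then serve groups of chains and ideals of integers.\<close>

definition additive_subgroup_of :: "'a::comm_ring_1 set \<Rightarrow> bool" where
  "additive_subgroup_of B \<longleftrightarrow> 0 \<in> B \<and> (\<forall>a\<in>B. \<forall>b\<in>B. a - b \<in> B)"

context
  fixes B :: "'a::comm_ring_1 set"
  assumes B: "additive_subgroup_of B"
begin

lemma asub_zero: "0 \<in> B"
  and asub_diff: "a \<in> B \<Longrightarrow> b \<in> B \<Longrightarrow> a - b \<in> B"
  using B by (auto simp: additive_subgroup_of_def)

lemma asub_uminus: "a \<in> B \<Longrightarrow> - a \<in> B"
  using asub_diff[OF asub_zero] by force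

lemma asub_add: "a \<in> B \<Longrightarrow> b \<in> B \<Longrightarrow> a + b \<in> B"
  using asub_diff[OF _ asub_uminus] by force

lemma asub_sum: "(\<And>i. i \<in> S \<Longrightarrow> a i \<in> B) \<Longrightarrow> (\<Sum>i\<in>S. a i) \<in> B"
  by (induction S rule: infinite_finite_induct) (auto intro: asub_zero asub_add)

lemma asub_scale:
  assumes "a \<in> B" shows "of_int k * a \<in> B"
proof (induction k rule: int_induct[where k = 0])
  case base
  show ?case by (simp add: asub_zero)
next
  case (step1 i)
  then show ?case using asub_add[OF assms step1(2)] by (simp add: algebra_simps)
next
  case (step2 i)
  then show ?case using asub_diff[OF _ assms] by (simp add: algebra_simps)
qed

end

section \<open>Finitely supported integer functions and linear extension\<close>

definition finsupp :: "('l \<Rightarrow> int) \<Rightarrow> bool" where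
  "finsupp c \<longleftrightarrow> finite {x. c x \<noteq> 0}"

definition single :: "'l \<Rightarrow> 'l \<Rightarrow> int" where
  "single x = (\<lambda>y. if y = x then 1 else 0)"

text \<open>The linear extension of \<open>F\<close> from basis elements to formal sums. For
  infinite support the sum takes its default value 0, which is why additivity requires
  \<open>finsupp\<close>.\<close>

definition lin :: "('l \<Rightarrow> 'a::comm_ring_1) \<Rightarrow> ('l \<Rightarrow> int) \<Rightarrow> 'a" where
  "lin F c = (\<Sum>x | c x \<noteq> 0. of_int (c x) * F x)"

lemma finsupp_zero [simp]: "finsupp 0"
  by (simp add: finsupp_def)

lemma finsupp_single [simp]: "finsupp (single x)"
  by (simp add: finsupp_def single_def)

lemma finsupp_add [simp]: "finsupp c \<Longrightarrow> finsupp d \<Longrightarrow> finsupp (c + d)"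
  unfolding finsupp_def by (rule finite_subset[of _ "{x. c x \<noteq> 0} \<union> {x. d x \<noteq> 0}"]) auto

lemma finsupp_diff [simp]: "finsupp c \<Longrightarrow> finsupp d \<Longrightarrow> finsupp (c - d)"
  unfolding finsupp_def by (rule finite_subset[of _ "{x. c x \<noteq> 0} \<union> {x. d x \<noteq> 0}"]) auto

lemma finsupp_uminus [simp]: "finsupp c \<Longrightarrow> finsupp (- c)"
  by (simp add: finsupp_def)

lemma finsupp_scale [simp]: "finsupp c \<Longrightarrow> finsupp (of_int k * c)"
  unfolding finsupp_def by (rule finite_subset[of _ "{x. c x \<noteq> 0}"]) auto

lemma finsupp_sum: "(\<And>i. i \<in> S \<Longrightarrow> finsupp (c i)) \<Longrightarrow> finsupp (\<Sum>i\<in>S. c i)"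
  by (induction S rule: infinite_finite_induct) simp_all

lemma finsupp_lin:
  "(\<And>x. c x \<noteq> 0 \<Longrightarrow> finsupp (K x)) \<Longrightarrow> finsupp (lin K c)"
  unfolding lin_def by (intro finsupp_sum finsupp_scale) simp

lemma lin_superset:
  "finite S \<Longrightarrow> {x. c x \<noteq> 0} \<subseteq> S \<Longrightarrow> lin F c = (\<Sum>x\<in>S. of_int (c x) * F x)"
  unfolding lin_def by (rule sum.mono_neutral_left) auto

lemma lin_cong: "(\<And>x. c x \<noteq> 0 \<Longrightarrow> F x = G x) \<Longrightarrow> lin F c = lin G c"
  unfolding lin_def by (rule sum.cong) auto

lemma lin_zero [simp]: "lin F 0 = 0"
  by (simp add: lin_def)

lemma lin_single [simp]: "lin F (single x) = F x"
  by (simp add: lin_def single_def)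

lemma lin_add: "finsupp c \<Longrightarrow> finsupp d \<Longrightarrow> lin F (c + d) = lin F c + lin F d"
proof -
  assume fin: "finsupp c" "finsupp d"
  let ?S = "{x. c x \<noteq> 0} \<union> {x. d x \<noteq> 0}"
  have S: "finite ?S" using fin by (simp add: finsupp_def)
  show ?thesis
    by (subst (1 2 3) lin_superset[OF S]) (auto simp: sum.distrib[symmetric] algebra_simps)
qed

lemma lin_scale: "finsupp c \<Longrightarrow> lin F (of_int k * c) = of_int k * lin F c"
proof -
  assume fin: "finsupp c"
  show ?thesis
    by (subst (1 2) lin_superset[OF fin[unfolded finsupp_def]]) (auto simp: sum_distrib_left mult.assoc)
qed

lemma lin_uminus: "finsupp c \<Longrightarrow> lin F (- c) = - lin F c"
  using lin_scale[of c F "-1"] by simp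

lemma lin_diff: "finsupp c \<Longrightarrow> finsupp d \<Longrightarrow> lin F (c - d) = lin F c - lin F d"
  using lin_add[of c "- d" F] by (simp add: lin_uminus)

lemma lin_sum:
  "(\<And>i. i \<in> S \<Longrightarrow> finsupp (c i)) \<Longrightarrow> lin F (\<Sum>i\<in>S. c i) = (\<Sum>i\<in>S. lin F (c i))"
proof (induction S rule: infinite_finite_induct)
  case (insert x S)
  have "finsupp (\<Sum>i\<in>S. c i)" using insert.prems by (intro finsupp_sum) auto
  then show ?case
    unfolding sum.insert[OF insert.hyps] using insert by (subst lin_add) auto
qed (simp_all add: lin_def)

text \<open>A composite of linear extensions is again one, so identities between composites of chain
  maps and functionals only have to be checked on basis elements.\<close>

lemma lin_lin:
  assumes "\<And>x. c x \<noteq> 0 \<Longrightarrow> finsupp (K x)"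
  shows "lin F (lin K c) = lin (\<lambda>x. lin F (K x)) c"
proof -
  have "lin F (lin K c) = (\<Sum>x | c x \<noteq> 0. lin F (of_int (c x) * K x))"
    unfolding lin_def[of K c] by (rule lin_sum) (use assms in \<open>intro finsupp_scale, simp\<close>)
  also have "\<dots> = lin (\<lambda>x. lin F (K x)) c"
    unfolding lin_def[of "\<lambda>x. lin F (K x)"] by (intro sum.cong refl lin_scale) (use assms in simp)
  finally show ?thesis .
qed

lemma lin_add_fun: "lin (\<lambda>x. F x + G x) c = lin F c + lin G c"
  by (simp add: lin_def sum.distrib algebra_simps)

lemma lin_diff_fun: "lin (\<lambda>x. F x - G x) c = lin F c - lin G c"
  by (simp add: lin_def sum_subtractf algebra_simps)

lemma lin_sum_fun: "lin (\<lambda>x. \<Sum>i\<in>S. F i x) c = (\<Sum>i\<in>S. lin (F i) c)"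
  by (simp add: lin_def sum_distrib_left sum.swap[of _ S])

lemma lin_mult_fun: "lin (\<lambda>x. of_int (a x) * v) c = of_int (lin a c) * v"
  by (simp add: lin_def sum_distrib_right mult.assoc)

lemma lin_in_asub:
  assumes "additive_subgroup_of B" "\<And>x. c x \<noteq> 0 \<Longrightarrow> F x \<in> B"
  shows "lin F c \<in> B"
  unfolding lin_def using assms by (auto intro!: asub_sum asub_scale)

lemma lin_singles: "finsupp c \<Longrightarrow> lin single c = c"
proof
  fix y assume fin: "finsupp c"
  have "lin single c y = (\<Sum>x | c x \<noteq> 0. if x = y then c x else 0)"
    unfolding lin_def by (simp add: single_def sum_fun_apply, intro sum.cong) auto
  also have "\<dots> = c y" using fin by (simp add: finsupp_def sum.delta)
  finally show "lin single c y = c y" .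
qed

section \<open>The bar complex in low degrees\<close>

lemma chainsD:
  assumes "c \<in> chains G k"
  shows "finsupp c" "c x \<noteq> 0 \<Longrightarrow> length x = k" "c x \<noteq> 0 \<Longrightarrow> set x \<subseteq> carrier G"
  using assms by (auto simp: chains_def finsupp_def)

lemma chains_subgroup: "additive_subgroup_of (chains G k)"
proof -
  have "a - b \<in> chains G k" if "a \<in> chains G k" "b \<in> chains G k" for a b
    unfolding chains_def
  proof (intro CollectI conjI allI impI)
    show "finite {x. (a - b) x \<noteq> 0}"
      using finsupp_diff[OF that[THEN chainsD(1)]] by (simp only: finsupp_def)
  next
    fix x assume "(a - b) x \<noteq> 0"
    then have "a x \<noteq> 0 \<or> b x \<noteq> 0" by auto
    then show "length x = k" "set x \<subseteq> carrier G" using that by (auto simp: chains_def)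
  qed
  moreover have "0 \<in> chains G k" by (simp add: chains_def)
  ultimately show ?thesis unfolding additive_subgroup_of_def by blast
qed

lemma single_chain: "length x = k \<Longrightarrow> set x \<subseteq> carrier G \<Longrightarrow> single x \<in> chains G k"
  by (simp add: chains_def single_def)

lemma bdry_eq_lin: "bdry G k c = lin (\<lambda>x. \<Sum>i\<le>k. of_int ((-1) ^ i) * single (face G i x)) c"
  unfolding fun_eq_iff bdry_def lin_def sum_fun_apply times_fun_apply of_int_fun_apply
  by (auto simp: single_def intro!: sum.cong)

lemma length_2E: "length x = 2 \<Longrightarrow> (\<And>a b. x = [a, b] \<Longrightarrow> P) \<Longrightarrow> P"
  by (auto simp: eval_nat_numeral length_Suc_conv)

lemma length_3E: "length x = 3 \<Longrightarrow> (\<And>a b c. x = [a, b, c] \<Longrightarrow> P) \<Longrightarrow> P"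
  by (auto simp: eval_nat_numeral length_Suc_conv)

text \<open>The bar differential of one basis element with the faces already evaluated. Being
  written with \<open>!\<close>, it is defined on all lists, but agrees with \<open>bdry\<close> on
  those of length 2; likewise \<open>bd3\<close> for length 3.\<close>

definition bd2 :: "('g, 'b) monoid_scheme \<Rightarrow> 'g list \<Rightarrow> 'g list \<Rightarrow> int" where
  "bd2 G x = single [x ! 1] - single [x ! 0 \<otimes>\<^bsub>G\<^esub> x ! 1] + single [x ! 0]"

definition bd3 :: "('g, 'b) monoid_scheme \<Rightarrow> 'g list \<Rightarrow> 'g list \<Rightarrow> int" where
  "bd3 G x = single [x ! 1, x ! 2] - single [x ! 0 \<otimes>\<^bsub>G\<^esub> x ! 1, x ! 2]
     + single [x ! 0, x ! 1 \<otimes>\<^bsub>G\<^esub> x ! 2] - single [x ! 0, x ! 1]"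

lemma finsupp_bd [simp]: "finsupp (bd2 G x)" "finsupp (bd3 G x)"
  unfolding bd2_def bd3_def by (intro finsupp_add finsupp_diff finsupp_single)+

lemma bdry2_lin: "c \<in> chains G 2 \<Longrightarrow> bdry G 2 c = lin (bd2 G) c"
  unfolding bdry_eq_lin
  by (rule lin_cong, drule (1) chainsD(2), erule length_2E)
    (simp add: bd2_def face_def eval_nat_numeral)

lemma bdry3_lin: "c \<in> chains G 3 \<Longrightarrow> bdry G 3 c = lin (bd3 G) c"
  unfolding bdry_eq_lin
  by (rule lin_cong, drule (1) chainsD(2), erule length_3E)
    (simp add: bd3_def face_def eval_nat_numeral)

lemma cycles2_iff: "c \<in> cycles2 G \<longleftrightarrow> c \<in> chains G 2 \<and> lin (bd2 G) c = 0"
  by (auto simp: cycles2_def bdry2_lin zero_fun_def)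

lemma boundaries2_eq: "boundaries2 G = lin (bd3 G) ` chains G 3"
  by (auto simp: boundaries2_def bdry3_lin)

lemma cycles2_subgroup: "additive_subgroup_of (cycles2 G)"
  unfolding additive_subgroup_of_def
  using asub_zero[OF chains_subgroup[of G 2]] asub_diff[OF chains_subgroup[of G 2]]
  by (auto simp: cycles2_iff lin_diff chainsD(1))

lemma boundaries2_subgroup: "additive_subgroup_of (boundaries2 G)"
  unfolding additive_subgroup_of_def boundaries2_eq
proof (intro conjI ballI)
  show "0 \<in> lin (bd3 G) ` chains G 3"
    using asub_zero[OF chains_subgroup] by (rule rev_image_eqI) simp
  fix a b assume "a \<in> lin (bd3 G) ` chains G 3" "b \<in> lin (bd3 G) ` chains G 3"
  then obtain c d where "c \<in> chains G 3" "d \<in> chains G 3" "a = lin (bd3 G) c" "b = lin (bd3 G) d"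
    by auto
  then show "a - b \<in> lin (bd3 G) ` chains G 3"
    using asub_diff[OF chains_subgroup, of c G 3 d] by (intro rev_image_eqI[of "c - d"]) (simp_all add: lin_diff chainsD(1))
qed

text \<open>The differential of \<open>[x|y|z]\<close>. The explicit relations modulo boundaries
  derived below are signed sums of instances of this one.\<close>

lemma bd3_boundary:
  assumes "x \<in> carrier G" "y \<in> carrier G" "z \<in> carrier G"
  shows "single [y, z] - single [x \<otimes>\<^bsub>G\<^esub> y, z] + single [x, y \<otimes>\<^bsub>G\<^esub> z] - single [x, y] \<in> boundaries2 G"
  unfolding boundaries2_eq
proof (rule rev_image_eqI)
  show "single [x, y, z] \<in> chains G 3" using assms by (intro single_chain) auto
qed (simp add: bd3_def)

lemma chains2E:
  assumes "c \<in> chains G 2" "c x \<noteq> 0"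
  obtains a b where "x = [a, b]" "a \<in> carrier G" "b \<in> carrier G"
  using chainsD(2,3)[OF assms] by (auto elim!: length_2E)

lemma chains3E:
  assumes "c \<in> chains G 3" "c x \<noteq> 0"
  obtains a b d where "x = [a, b, d]" "a \<in> carrier G" "b \<in> carrier G" "d \<in> carrier G"
  using chainsD(2,3)[OF assms] by (auto elim!: length_3E)

text \<open>Two successive differentials compose to zero: on a basis element all terms cancel in
  pairs, the two bracketings of the triple product by associativity.\<close>

lemma (in monoid) boundaries2_subset_cycles2: "boundaries2 G \<subseteq> cycles2 G"
proof
  fix b assume "b \<in> boundaries2 G"
  then obtain c where c: "c \<in> chains G 3" "b = lin (bd3 G) c"
    by (auto simp: boundaries2_eq)
  have "b \<in> chains G 2" unfolding c
  proof (rule lin_in_asub[OF chains_subgroup])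
    fix x assume "c x \<noteq> 0"
    then show "bd3 G x \<in> chains G 2"
      by (rule chains3E[OF c(1)])
        (auto simp: bd3_def intro!: asub_add[OF chains_subgroup] asub_diff[OF chains_subgroup] single_chain)
  qed
  moreover have "lin (bd2 G) b = lin (\<lambda>x. 0) c" unfolding c
  proof (subst lin_lin, simp, rule lin_cong)
    fix x assume "c x \<noteq> 0"
    then show "lin (bd2 G) (bd3 G x) = 0"
      by (rule chains3E[OF c(1)])
        (simp add: bd3_def lin_add lin_diff bd2_def m_assoc)
  qed
  ultimately show "b \<in> cycles2 G" by (simp add: cycles2_iff lin_def)
qed

section \<open>Functoriality of bar chains\<close>

definition push :: "('g \<Rightarrow> 'h) \<Rightarrow> ('g list \<Rightarrow> int) \<Rightarrow> 'h list \<Rightarrow> int" where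
  "push p c = lin (\<lambda>x. single (map p x)) c"

lemma finsupp_push [simp]: "finsupp (push p c)"
  unfolding push_def by (rule finsupp_lin) simp

lemma lin_push: "lin F (push p c) = lin (\<lambda>x. F (map p x)) c"
  unfolding push_def using lin_lin[of c "\<lambda>x. single (map p x)" F] by simp

lemma push_push: "push q (push p c) = push (\<lambda>x. q (p x)) c"
  unfolding push_def[of q] lin_push by (simp add: push_def comp_def)

lemma push_add: "finsupp c \<Longrightarrow> finsupp d \<Longrightarrow> push p (c + d) = push p c + push p d"
  by (simp add: push_def lin_add)

lemma push_chain:
  assumes "p \<in> carrier G \<rightarrow> carrier H" "c \<in> chains G k"
  shows "push p c \<in> chains H k"
  unfolding push_def
proof (rule lin_in_asub[OF chains_subgroup], rule single_chain)
  fix x assume "c x \<noteq> 0"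
  then have "length x = k" "set x \<subseteq> carrier G" using chainsD(2,3)[OF assms(2)] by auto
  then show "length (map p x) = k" "set (map p x) \<subseteq> carrier H" using assms(1) by auto
qed

text \<open>A homomorphism commutes with the face maps, hence \<open>push p\<close> commutes with
  the differential; \<open>push_boundary\<close> is the same argument one degree higher.\<close>

lemma push_cycle:
  assumes p: "p \<in> hom G H" and c: "c \<in> cycles2 G"
  shows "push p c \<in> cycles2 H"
proof -
  have p': "p \<in> carrier G \<rightarrow> carrier H" using p by (simp add: hom_def)
  have c': "c \<in> chains G 2" "lin (bd2 G) c = 0" using c by (auto simp: cycles2_iff)
  have "lin (bd2 H) (push p c) = lin (\<lambda>x. push p (bd2 G x)) c" unfolding lin_push
    by (rule lin_cong, erule chains2E[OF c'(1)])
      (simp add: bd2_def push_def lin_add lin_diff hom_mult[OF p])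
  also have "\<dots> = push p (lin (bd2 G) c)"
    unfolding push_def by (rule lin_lin[symmetric]) simp
  finally show ?thesis using c' push_chain[OF p'] by (simp add: cycles2_iff push_def)
qed

lemma push_boundary:
  assumes p: "p \<in> hom G H" and b: "b \<in> boundaries2 G"
  shows "push p b \<in> boundaries2 H"
proof -
  have p': "p \<in> carrier G \<rightarrow> carrier H" using p by (simp add: hom_def)
  obtain c where c: "c \<in> chains G 3" "b = lin (bd3 G) c"
    using b by (auto simp: boundaries2_eq)
  have "lin (bd3 H) (push p c) = lin (\<lambda>x. push p (bd3 G x)) c" unfolding lin_push
    by (rule lin_cong, erule chains3E[OF c(1)])
      (simp add: bd3_def push_def lin_add lin_diff hom_mult[OF p])
  also have "\<dots> = push p b"
    unfolding push_def c(2) by (rule lin_lin[symmetric]) simp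
  finally show ?thesis using push_chain[OF p' c(1)] by (metis boundaries2_eq imageI)
qed

section \<open>The Kuenneth formula in degree two\<close>

text \<open>For commuting \<open>a\<close> and \<open>b\<close> this cycle represents their
  Pontryagin product, the image of a generator of the second homology of the free abelian group of
  rank two.\<close>

definition commutator_chain :: "'g \<Rightarrow> 'g \<Rightarrow> 'g list \<Rightarrow> int" where
  "commutator_chain a b = single [a, b] - single [b, a]"

lemma finsupp_commutator_chain [simp]: "finsupp (commutator_chain a b)"
  by (simp add: commutator_chain_def)

lemma commutator_chain_swap: "commutator_chain b a = - commutator_chain a b"
  by (simp add: commutator_chain_def)

lemma commutator_chain_cycle:
  assumes "a \<in> carrier G" "b \<in> carrier G" "a \<otimes>\<^bsub>G\<^esub> b = b \<otimes>\<^bsub>G\<^esub> a"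
  shows "commutator_chain a b \<in> cycles2 G"
  using assms unfolding cycles2_iff commutator_chain_def
  by (auto intro!: asub_diff[OF chains_subgroup] single_chain simp: lin_diff bd2_def)

text \<open>The difference bounds the shuffle product of \<open>[a]\<close> with
  \<open>[b|b']\<close>.\<close>

lemma (in monoid) commutator_chain_mult:
  assumes [simp]: "a \<in> carrier G" "b \<in> carrier G" "b' \<in> carrier G"
    and "a \<otimes> b = b \<otimes> a" "a \<otimes> b' = b' \<otimes> a"
  shows "commutator_chain a (b \<otimes> b') - (commutator_chain a b + commutator_chain a b')
           \<in> boundaries2 G"
proof -
  let ?D = "\<lambda>x y z. single [y, z] - single [x \<otimes> y, z] + single [x, y \<otimes> z] - single [x, y]"
  \<comment> \<open>The three positions of \<open>a\<close> relative to \<open>b, b'\<close>, with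
    the signs of the shuffles.\<close>
  have "?D a b b' - ?D b a b' + ?D b b' a \<in> boundaries2 G"
    by (intro asub_add[OF boundaries2_subgroup] asub_diff[OF boundaries2_subgroup] bd3_boundary) simp_all
  also have "?D a b b' - ?D b a b' + ?D b b' a =
      commutator_chain a (b \<otimes> b') - (commutator_chain a b + commutator_chain a b')"
    using assms(4,5) by (simp add: commutator_chain_def)
  finally show ?thesis .
qed

text \<open>In the central extension given by the universal cocycle \<open>(x, y) \<mapsto> [x|y]\<close>,
  change the section so that it is multiplicative on products \<open>gh\<close>; the cocycle then splits into its
  restrictions to the two commuting factors and the commutator pairing of \<open>h\<close> with \<open>g'\<close>.\<close>
lemma (in monoid) single_product_decomposition:
  assumes [simp]: "g \<in> carrier G" "h \<in> carrier G" "g' \<in> carrier G" "h' \<in> carrier G"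
    and comm: "h \<otimes> g' = g' \<otimes> h"
  shows "single [g \<otimes> h, g' \<otimes> h'] + single [g, h] + single [g', h'] - single [g \<otimes> g', h \<otimes> h']
           - single [g, g'] - single [h, h'] - commutator_chain h g' \<in> boundaries2 G"
proof -
  let ?D = "\<lambda>x y z. single [y, z] - single [x \<otimes> y, z] + single [x, y \<otimes> z] - single [x, y]"
  have "?D h g' h' - ?D g h (g' \<otimes> h') - ?D g' h h' + ?D g g' (h \<otimes> h') \<in> boundaries2 G"
    by (intro asub_add[OF boundaries2_subgroup] asub_diff[OF boundaries2_subgroup] bd3_boundary) simp_all
  moreover have "h \<otimes> (g' \<otimes> h') = g' \<otimes> (h \<otimes> h')"
    using comm by (simp add: m_assoc[symmetric])
  ultimately show ?thesis
    using comm by (simp add: commutator_chain_def algebra_simps)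
qed

text \<open>Both \<open>[1|x]\<close> and \<open>[x|1]\<close> are homologous to
  \<open>[1|1]\<close>.\<close>

lemma (in monoid) single_one_swap_boundary:
  assumes "x \<in> carrier G"
  shows "commutator_chain \<one> x \<in> boundaries2 G"
  using asub_add[OF boundaries2_subgroup bd3_boundary[of x G \<one> \<one>] bd3_boundary[of \<one> G \<one> x]] assms
  by (simp add: commutator_chain_def)

text \<open>Allows \<open>lin_in_asub\<close> to prove divisibility of integer-valued functionals on
  chains.\<close>

lemma dvd_subgroup: "additive_subgroup_of {k::int. m dvd k}"
  by (auto simp: additive_subgroup_of_def)

text \<open>Each \<open>bd2 G x\<close> has coefficient sum 1 - 1 + 1 = 1, so the differential
  preserves the coefficient sum. Needed to see that a cycle pushed into the trivial group
  vanishes.\<close>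

lemma sum_of_cycle:
  assumes "c \<in> cycles2 G"
  shows "lin (\<lambda>_. 1 :: int) c = 0"
proof -
  have "lin (\<lambda>_. 1 :: int) (lin (bd2 G) c) = lin (\<lambda>_. 1) c"
    by (subst lin_lin) (simp_all add: bd2_def lin_add lin_diff)
  then show ?thesis using assms by (simp add: cycles2_iff)
qed

text \<open>The product is described by projections and a pairing map \<open>q\<close> instead of
  \<open>DirProd\<close>, since a matrix over a product ring is not literally a pair of
  matrices.\<close>

locale group_product = P: group P + G: group G + H: group H
  for P :: "('p, 'x) monoid_scheme" and G :: "('g, 'y) monoid_scheme" and H :: "('h, 'z) monoid_scheme" +
  fixes p1 :: "'p \<Rightarrow> 'g" and p2 :: "'p \<Rightarrow> 'h" and q :: "'g \<Rightarrow> 'h \<Rightarrow> 'p"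
  assumes p1: "p1 \<in> hom P G" and p2: "p2 \<in> hom P H"
    and q_closed [simp]: "g \<in> carrier G \<Longrightarrow> h \<in> carrier H \<Longrightarrow> q g h \<in> carrier P"
    and p1_q [simp]: "g \<in> carrier G \<Longrightarrow> h \<in> carrier H \<Longrightarrow> p1 (q g h) = g"
    and p2_q [simp]: "g \<in> carrier G \<Longrightarrow> h \<in> carrier H \<Longrightarrow> p2 (q g h) = h"
    and q_p: "x \<in> carrier P \<Longrightarrow> q (p1 x) (p2 x) = x"
begin

definition i1 where "i1 g = q g \<one>\<^bsub>H\<^esub>"
definition i2 where "i2 h = q \<one>\<^bsub>G\<^esub> h"

lemma p_closed [simp]: "x \<in> carrier P \<Longrightarrow> p1 x \<in> carrier G" "x \<in> carrier P \<Longrightarrow> p2 x \<in> carrier H"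
  using p1 p2 by (auto simp: hom_in_carrier)

lemma p_mult [simp]:
  "x \<in> carrier P \<Longrightarrow> y \<in> carrier P \<Longrightarrow> p1 (x \<otimes>\<^bsub>P\<^esub> y) = p1 x \<otimes>\<^bsub>G\<^esub> p1 y"
  "x \<in> carrier P \<Longrightarrow> y \<in> carrier P \<Longrightarrow> p2 (x \<otimes>\<^bsub>P\<^esub> y) = p2 x \<otimes>\<^bsub>H\<^esub> p2 y"
  using p1 p2 by (auto simp: hom_mult)

lemma i_closed [simp]: "g \<in> carrier G \<Longrightarrow> i1 g \<in> carrier P" "h \<in> carrier H \<Longrightarrow> i2 h \<in> carrier P"
  by (simp_all add: i1_def i2_def)

lemma p_i [simp]:
  "g \<in> carrier G \<Longrightarrow> p1 (i1 g) = g" "h \<in> carrier H \<Longrightarrow> p2 (i2 h) = h"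
  "g \<in> carrier G \<Longrightarrow> p2 (i1 g) = \<one>\<^bsub>H\<^esub>" "h \<in> carrier H \<Longrightarrow> p1 (i2 h) = \<one>\<^bsub>G\<^esub>"
  by (simp_all add: i1_def i2_def)

lemma p_ext: "x \<in> carrier P \<Longrightarrow> y \<in> carrier P \<Longrightarrow> p1 x = p1 y \<Longrightarrow> p2 x = p2 y \<Longrightarrow> x = y"
  by (metis q_p)

lemma i1: "i1 \<in> hom G P" and i2: "i2 \<in> hom H P"
  by (auto intro!: homI p_ext)

lemma i_p: "x \<in> carrier P \<Longrightarrow> i1 (p1 x) \<otimes>\<^bsub>P\<^esub> i2 (p2 x) = x"
  by (rule p_ext) simp_all

lemma i_commute:
  "g \<in> carrier G \<Longrightarrow> h \<in> carrier H \<Longrightarrow> i2 h \<otimes>\<^bsub>P\<^esub> i1 g = i1 g \<otimes>\<^bsub>P\<^esub> i2 h"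
  by (rule p_ext) simp_all

abbreviation pairing :: "'h \<Rightarrow> 'g \<Rightarrow> 'p list \<Rightarrow> int" where
  "pairing h g \<equiv> commutator_chain (i2 h) (i1 g)"

lemma pairing_mult_left:
  assumes "h \<in> carrier H" "h' \<in> carrier H" "g \<in> carrier G"
  shows "pairing (h \<otimes>\<^bsub>H\<^esub> h') g - (pairing h g + pairing h' g) \<in> boundaries2 P"
proof -
  have "commutator_chain (i1 g) (i2 h \<otimes>\<^bsub>P\<^esub> i2 h')
      - (commutator_chain (i1 g) (i2 h) + commutator_chain (i1 g) (i2 h')) \<in> boundaries2 P"
    using assms by (intro P.commutator_chain_mult) (simp_all add: i_commute)
  from asub_uminus[OF boundaries2_subgroup this] show ?thesis
    using assms by (simp add: commutator_chain_swap[of "i1 g"] hom_mult[OF i2] algebra_simps)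
qed

lemma pairing_mult_right:
  assumes "h \<in> carrier H" "g \<in> carrier G" "g' \<in> carrier G"
  shows "pairing h (g \<otimes>\<^bsub>G\<^esub> g') - (pairing h g + pairing h g') \<in> boundaries2 P"
  using P.commutator_chain_mult[of "i2 h" "i1 g" "i1 g'"] assms
  by (simp add: i_commute hom_mult[OF i1])

text \<open>Each basis element \<open>[a|b]\<close> is split by
  \<open>single_product_decomposition\<close>; the terms coming from the change of section cancel in
  the sum over a cycle.\<close>

lemma cycle_decomposition:
  assumes c: "c \<in> cycles2 P"
  shows "c - (push i1 (push p1 c) + push i2 (push p2 c) + lin (\<lambda>x. pairing (p2 (x ! 0)) (p1 (x ! 1))) c)
           \<in> boundaries2 P"
proof -
  have c': "c \<in> chains P 2" "lin (bd2 P) c = 0" "finsupp c"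
    using c by (auto simp: cycles2_iff dest: chainsD(1))
  \<comment> \<open>The last bracket of \<open>F x\<close> is the linear extension of
    \<open>\<phi>\<close> evaluated on \<open>bd2 P x\<close>. Summed over \<open>c\<close> it
    becomes the value at the differential of \<open>c\<close>, which is zero.\<close>
  define \<phi> where "\<phi> x = single [i1 (p1 x), i2 (p2 x)]" for x
  define F where "F x = single x - single (map (\<lambda>y. i1 (p1 y)) x) - single (map (\<lambda>y. i2 (p2 y)) x)
    - pairing (p2 (x ! 0)) (p1 (x ! 1)) + (\<phi> (x ! 1) - \<phi> (x ! 0 \<otimes>\<^bsub>P\<^esub> x ! 1) + \<phi> (x ! 0))" for x
  have "lin F c \<in> boundaries2 P"
  proof (rule lin_in_asub[OF boundaries2_subgroup])
    fix x assume "c x \<noteq> 0"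
    then obtain a b where x: "x = [a, b]" "a \<in> carrier P" "b \<in> carrier P"
      by (rule chains2E[OF c'(1)])
    have "single [i1 (p1 a) \<otimes>\<^bsub>P\<^esub> i2 (p2 a), i1 (p1 b) \<otimes>\<^bsub>P\<^esub> i2 (p2 b)]
        + single [i1 (p1 a), i2 (p2 a)] + single [i1 (p1 b), i2 (p2 b)]
        - single [i1 (p1 a) \<otimes>\<^bsub>P\<^esub> i1 (p1 b), i2 (p2 a) \<otimes>\<^bsub>P\<^esub> i2 (p2 b)]
        - single [i1 (p1 a), i1 (p1 b)] - single [i2 (p2 a), i2 (p2 b)]
        - pairing (p2 a) (p1 b) \<in> boundaries2 P"
      using x by (intro P.single_product_decomposition) (simp_all add: i_commute)
    then show "F x \<in> boundaries2 P"
      using x by (simp add: F_def \<phi>_def i_p hom_mult[OF i1] hom_mult[OF i2] algebra_simps)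
  qed
  moreover have "lin (\<lambda>x. \<phi> (x ! 1) - \<phi> (x ! 0 \<otimes>\<^bsub>P\<^esub> x ! 1) + \<phi> (x ! 0)) c
      = lin (\<lambda>y. \<phi> (y ! 0)) (lin (bd2 P) c)"
    by (subst lin_lin) (simp_all add: bd2_def lin_add lin_diff)
  ultimately show ?thesis
    unfolding F_def lin_add_fun[of _ "\<lambda>x. \<phi> (x ! 1) - \<phi> (x ! 0 \<otimes>\<^bsub>P\<^esub> x ! 1) + \<phi> (x ! 0)"] lin_diff_fun
    using c' by (simp add: lin_singles push_push push_def[symmetric] diff_diff_eq)
qed

end

section \<open>The Schur multiplier as a group of homology classes\<close>

lemma cycles2_group_simps [simp]:
  "carrier (cycles2_group G) = cycles2 G" "a \<otimes>\<^bsub>cycles2_group G\<^esub> b = a + b" "\<one>\<^bsub>cycles2_group G\<^esub> = 0"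
  by (simp_all add: cycles2_group_def plus_fun_def zero_fun_def)

lemma comm_group_cycles2: "comm_group (cycles2_group G)"
proof (rule comm_groupI)
  fix x assume "x \<in> carrier (cycles2_group G)"
  then have "- x \<in> cycles2 G" by (simp add: asub_uminus[OF cycles2_subgroup])
  then show "\<exists>y\<in>carrier (cycles2_group G). y \<otimes>\<^bsub>cycles2_group G\<^esub> x = \<one>\<^bsub>cycles2_group G\<^esub>"
    by (intro bexI[of _ "- x"]) simp_all
qed (simp_all add: asub_add[OF cycles2_subgroup] asub_zero[OF cycles2_subgroup] algebra_simps)

lemma (in monoid) boundaries2_normal: "boundaries2 G \<lhd> cycles2_group G"
proof -
  interpret Z: comm_group "cycles2_group G" by (rule comm_group_cycles2)
  have "subgroup (boundaries2 G) (cycles2_group G)"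
  proof (rule Z.subgroupI)
    show "boundaries2 G \<subseteq> carrier (cycles2_group G)" using boundaries2_subset_cycles2 by simp
    show "boundaries2 G \<noteq> {}" using asub_zero[OF boundaries2_subgroup] by auto
  next
    fix a assume a: "a \<in> boundaries2 G"
    then have "- a \<in> boundaries2 G" by (rule asub_uminus[OF boundaries2_subgroup])
    moreover have "inv\<^bsub>cycles2_group G\<^esub> a = - a"
      using a calculation boundaries2_subset_cycles2 by (intro Z.inv_equality) auto
    ultimately show "inv\<^bsub>cycles2_group G\<^esub> a \<in> boundaries2 G" by simp
  qed (simp add: asub_add[OF boundaries2_subgroup])
  then show ?thesis by (rule Z.subgroup_imp_normal)
qed

lemma (in monoid) group_schur_multiplier: "group (schur_multiplier G)"
  unfolding schur_multiplier_def by (rule normal.factorgroup_is_group[OF boundaries2_normal])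

definition homology_class :: "('g, 'b) monoid_scheme \<Rightarrow> ('g list \<Rightarrow> int) \<Rightarrow> ('g list \<Rightarrow> int) set" where
  "homology_class G c = boundaries2 G #>\<^bsub>cycles2_group G\<^esub> c"

context monoid
begin

lemma homology_class_hom: "homology_class G \<in> hom (cycles2_group G) (schur_multiplier G)"
  unfolding schur_multiplier_def homology_class_def
  by (rule normal.r_coset_hom_Mod[OF boundaries2_normal])

lemma homology_class_surj:
  "x \<in> carrier (schur_multiplier G) \<Longrightarrow> \<exists>c\<in>cycles2 G. x = homology_class G c"
  by (auto simp: schur_multiplier_def homology_class_def FactGroup_def RCOSETS_def)

lemma homology_class_eq_one:
  assumes "c \<in> cycles2 G"
  shows "homology_class G c = \<one>\<^bsub>schur_multiplier G\<^esub> \<longleftrightarrow> c \<in> boundaries2 G"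
proof -
  interpret Z: comm_group "cycles2_group G" by (rule comm_group_cycles2)
  have "subgroup (boundaries2 G) (cycles2_group G)"
    using boundaries2_normal by (rule normal_imp_subgroup)
  then show ?thesis
    using assms Z.coset_join1 Z.coset_join2
    by (auto simp: schur_multiplier_def homology_class_def FactGroup_def)
qed

lemma homology_class_eqI:
  assumes "b \<in> cycles2 G" "a - b \<in> boundaries2 G"
  shows "homology_class G a = homology_class G b"
proof -
  interpret Z: comm_group "cycles2_group G" by (rule comm_group_cycles2)
  have "a = (a - b) + b" by simp
  then have "a \<in> boundaries2 G #>\<^bsub>cycles2_group G\<^esub> b"
    using assms(2) unfolding r_coset_def by force
  then show ?thesis
    unfolding homology_class_def using assms normal_imp_subgroup[OF boundaries2_normal]
    by (intro Z.repr_independence[symmetric]) auto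
qed

end

text \<open>
  The last three assumptions say that the abelianization of \<open>G\<close> is generated by the classes of the \<open>e i\<close>,
  of exponent \<open>m\<close>, with coordinates \<open>\<alpha>\<close> (and that of \<open>H\<close> by the \<open>f j\<close>), tested on homomorphisms into quotients
  \<open>C\<^sub>2(P)/B\<close>; these are written as maps \<open>\<phi>\<close> into chains that are additive modulo \<open>B\<close>.
\<close>
locale kunneth = group_product P G H p1 p2 q
  for P :: "('p, 'x) monoid_scheme" and G :: "('g, 'y) monoid_scheme" and H :: "('h, 'z) monoid_scheme"
    and p1 p2 q +
  fixes m r s :: nat and \<alpha> :: "nat \<Rightarrow> 'g \<Rightarrow> int" and \<beta> :: "nat \<Rightarrow> 'h \<Rightarrow> int"
    and e :: "nat \<Rightarrow> 'g" and f :: "nat \<Rightarrow> 'h"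
  assumes m: "m > 0"
    and alpha_mult: "i < r \<Longrightarrow> g \<in> carrier G \<Longrightarrow> g' \<in> carrier G \<Longrightarrow>
      [\<alpha> i (g \<otimes>\<^bsub>G\<^esub> g') = \<alpha> i g + \<alpha> i g'] (mod int m)"
    and beta_mult: "j < s \<Longrightarrow> h \<in> carrier H \<Longrightarrow> h' \<in> carrier H \<Longrightarrow>
      [\<beta> j (h \<otimes>\<^bsub>H\<^esub> h') = \<beta> j h + \<beta> j h'] (mod int m)"
    and e [simp]: "i < r \<Longrightarrow> e i \<in> carrier G"
    and f [simp]: "j < s \<Longrightarrow> f j \<in> carrier H"
    and alpha_e: "i < r \<Longrightarrow> k < r \<Longrightarrow> [\<alpha> i (e k) = (if i = k then 1 else 0)] (mod int m)"
    and beta_f: "j < s \<Longrightarrow> k < s \<Longrightarrow> [\<beta> j (f k) = (if j = k then 1 else 0)] (mod int m)"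
    and torsion_G: "\<lbrakk>additive_subgroup_of B; \<And>g g'. g \<in> carrier G \<Longrightarrow> g' \<in> carrier G \<Longrightarrow>
        \<phi> (g \<otimes>\<^bsub>G\<^esub> g') - (\<phi> g + \<phi> g') \<in> B; i < r\<rbrakk> \<Longrightarrow>
        of_int (int m) * \<phi> (e i) \<in> (B :: ('p list \<Rightarrow> int) set)"
    and generate_G: "\<lbrakk>additive_subgroup_of B; \<And>g g'. g \<in> carrier G \<Longrightarrow> g' \<in> carrier G \<Longrightarrow>
        \<phi> (g \<otimes>\<^bsub>G\<^esub> g') - (\<phi> g + \<phi> g') \<in> B; g \<in> carrier G\<rbrakk> \<Longrightarrow>
        \<phi> g - (\<Sum>i<r. of_int (\<alpha> i g) * \<phi> (e i)) \<in> (B :: ('p list \<Rightarrow> int) set)"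
    and generate_H: "\<lbrakk>additive_subgroup_of B; \<And>h h'. h \<in> carrier H \<Longrightarrow> h' \<in> carrier H \<Longrightarrow>
        \<psi> (h \<otimes>\<^bsub>H\<^esub> h') - (\<psi> h + \<psi> h') \<in> B; h \<in> carrier H\<rbrakk> \<Longrightarrow>
        \<psi> h - (\<Sum>j<s. of_int (\<beta> j h) * \<psi> (f j)) \<in> (B :: ('p list \<Rightarrow> int) set)"
begin

text \<open>The cup product of the pullbacks of \<open>\<beta> j\<close> and
  \<open>\<alpha> i\<close>, evaluated on \<open>c\<close>: the coefficient at the pairing of
  \<open>f j\<close> with \<open>e i\<close>. It is an integer, but only its residue modulo
  \<open>m\<close> depends on the homology class alone.\<close>

definition tensor :: "nat \<Rightarrow> nat \<Rightarrow> ('p list \<Rightarrow> int) \<Rightarrow> int" where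
  "tensor i j c = lin (\<lambda>x. \<beta> j (p2 (x ! 0)) * \<alpha> i (p1 (x ! 1))) c"

lemma alpha_one: "i < r \<Longrightarrow> [\<alpha> i \<one>\<^bsub>G\<^esub> = 0] (mod int m)"
  using alpha_mult[of i "\<one>\<^bsub>G\<^esub>" "\<one>\<^bsub>G\<^esub>"] by (simp add: cong_iff_dvd_diff)

lemma beta_one: "j < s \<Longrightarrow> [\<beta> j \<one>\<^bsub>H\<^esub> = 0] (mod int m)"
  using beta_mult[of j "\<one>\<^bsub>H\<^esub>" "\<one>\<^bsub>H\<^esub>"] by (simp add: cong_iff_dvd_diff)

text \<open>A product of two maps that are additive modulo \<open>m\<close> is a 2-cocycle modulo
  \<open>m\<close>: biadditivity cancels the four terms of each \<open>bd3 P x\<close>.\<close>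

lemma tensor_boundary:
  assumes b: "b \<in> boundaries2 P" and ij: "i < r" "j < s"
  shows "int m dvd tensor i j b"
proof -
  obtain c where c: "c \<in> chains P 3" "b = lin (bd3 P) c"
    using b by (auto simp: boundaries2_eq)
  have "tensor i j b = lin (\<lambda>x. lin (\<lambda>x. \<beta> j (p2 (x ! 0)) * \<alpha> i (p1 (x ! 1))) (bd3 P x)) c"
    unfolding tensor_def c(2) by (rule lin_lin) simp
  also have "\<dots> \<in> {k. int m dvd k}"
  proof (rule lin_in_asub[OF dvd_subgroup])
    fix x assume "c x \<noteq> 0"
    then obtain u v w where x: "x = [u, v, w]" "u \<in> carrier P" "v \<in> carrier P" "w \<in> carrier P"
      by (rule chains3E[OF c(1)])
    have "[\<beta> j (p2 v) * \<alpha> i (p1 w) - \<beta> j (p2 (u \<otimes>\<^bsub>P\<^esub> v)) * \<alpha> i (p1 w)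
        + \<beta> j (p2 u) * \<alpha> i (p1 (v \<otimes>\<^bsub>P\<^esub> w)) - \<beta> j (p2 u) * \<alpha> i (p1 v)
      = \<beta> j (p2 v) * \<alpha> i (p1 w) - (\<beta> j (p2 u) + \<beta> j (p2 v)) * \<alpha> i (p1 w)
        + \<beta> j (p2 u) * (\<alpha> i (p1 v) + \<alpha> i (p1 w)) - \<beta> j (p2 u) * \<alpha> i (p1 v)] (mod int m)"
      using ij x by (simp only: p_mult) (intro cong_add cong_diff cong_mult cong_refl alpha_mult beta_mult; simp)
    also have "\<beta> j (p2 v) * \<alpha> i (p1 w) - (\<beta> j (p2 u) + \<beta> j (p2 v)) * \<alpha> i (p1 w)
        + \<beta> j (p2 u) * (\<alpha> i (p1 v) + \<alpha> i (p1 w)) - \<beta> j (p2 u) * \<alpha> i (p1 v) = 0"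
      by (simp add: algebra_simps)
    finally show "lin (\<lambda>x. \<beta> j (p2 (x ! 0)) * \<alpha> i (p1 (x ! 1))) (bd3 P x) \<in> {k. int m dvd k}"
      by (simp add: x(1) bd3_def lin_add lin_diff cong_0_iff)
  qed
  finally show ?thesis by simp
qed

text \<open>Modulo boundaries the pairing is additive in each argument, so it is expanded first in
  \<open>g\<close> by \<open>generate_G\<close> and then, for each \<open>e i\<close>, in
  \<open>h\<close> by \<open>generate_H\<close>.\<close>

lemma pairing_generators:
  assumes g: "g \<in> carrier G" and h: "h \<in> carrier H"
  shows "pairing h g - (\<Sum>i<r. \<Sum>j<s. of_int (\<beta> j h * \<alpha> i g) * pairing (f j) (e i)) \<in> boundaries2 P"
proof -
  note B = boundaries2_subgroup[of P]
  have 1: "pairing h g - (\<Sum>i<r. of_int (\<alpha> i g) * pairing h (e i)) \<in> boundaries2 P"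
    by (rule generate_G[OF B]) (use g h in \<open>auto intro: pairing_mult_right\<close>)
  have "pairing h (e i) - (\<Sum>j<s. of_int (\<beta> j h) * pairing (f j) (e i)) \<in> boundaries2 P" if "i < r" for i
    by (rule generate_H[OF B]) (use that h in \<open>auto intro: pairing_mult_left\<close>)
  then have "(\<Sum>i<r. of_int (\<alpha> i g) * (pairing h (e i) - (\<Sum>j<s. of_int (\<beta> j h) * pairing (f j) (e i))))
      \<in> boundaries2 P"
    by (intro asub_sum[OF B] asub_scale[OF B]) auto
  from asub_add[OF B 1 this] show ?thesis
    by (simp add: sum_subtractf algebra_simps sum_distrib_left)
qed

text \<open>For fixed \<open>f j\<close> the pairing is additive in its second argument, so
  \<open>m\<close> times it vanishes by \<open>torsion_G\<close>.\<close>

lemma pairing_torsion: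
  assumes "i < r" "j < s" "int m dvd k"
  shows "of_int k * pairing (f j) (e i) \<in> boundaries2 P"
proof -
  note B = boundaries2_subgroup[of P]
  obtain l where k: "k = l * int m" using assms(3) by (metis dvdE mult.commute)
  have "of_int (int m) * pairing (f j) (e i) \<in> boundaries2 P"
    by (rule torsion_G[OF B]) (use assms in \<open>auto intro: pairing_mult_right\<close>)
  from asub_scale[OF B this, of l] show ?thesis by (simp add: k mult.assoc)
qed

text \<open>The injectivity half of the Kuenneth formula. Conversely to functoriality,
  \<open>cycle_decomposition\<close> writes a cycle through its projections and pairings, and the
  right-hand side makes each of these parts a boundary.\<close>

lemma boundary_iff:
  assumes c: "c \<in> cycles2 P"
  shows "c \<in> boundaries2 P \<longleftrightarrow> push p1 c \<in> boundaries2 G \<and> push p2 c \<in> boundaries2 H \<and>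
    (\<forall>i<r. \<forall>j<s. int m dvd tensor i j c)" (is "_ \<longleftrightarrow> ?R")
proof
  assume "c \<in> boundaries2 P"
  then show ?R using push_boundary[OF p1] push_boundary[OF p2] tensor_boundary by blast
next
  assume R: ?R
  note B = boundaries2_subgroup[of P]
  have c': "c \<in> chains P 2" using c by (simp add: cycles2_iff)
  define S where "S = (\<Sum>i<r. \<Sum>j<s. of_int (tensor i j c) * pairing (f j) (e i))"
  \<comment> \<open>Expanding every pairing in generators and collecting coefficients over
    \<open>c\<close> produces exactly the numbers \<open>tensor i j c\<close>.\<close>
  have "lin (\<lambda>x. pairing (p2 (x ! 0)) (p1 (x ! 1)) -
      (\<Sum>i<r. \<Sum>j<s. of_int (\<beta> j (p2 (x ! 0)) * \<alpha> i (p1 (x ! 1))) * pairing (f j) (e i))) c \<in> boundaries2 P"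
    by (rule lin_in_asub[OF B], erule chains2E[OF c']) (simp only: nth_Cons_0 nth_Cons_Suc One_nat_def, intro pairing_generators, simp_all)
  then have 1: "lin (\<lambda>x. pairing (p2 (x ! 0)) (p1 (x ! 1))) c - S \<in> boundaries2 P"
    unfolding lin_diff_fun lin_sum_fun lin_mult_fun S_def tensor_def .
  have 2: "S \<in> boundaries2 P"
    unfolding S_def using R by (intro asub_sum[OF B] pairing_torsion) auto
  have 3: "push i1 (push p1 c) + push i2 (push p2 c) \<in> boundaries2 P"
    using R by (intro asub_add[OF B] push_boundary[OF i1] push_boundary[OF i2]) auto
  from asub_add[OF B asub_add[OF B cycle_decomposition[OF c] 3] asub_add[OF B 1 2]]
  show "c \<in> boundaries2 P" by (simp add: algebra_simps)
qed

lemma tensor_add: "finsupp c \<Longrightarrow> finsupp d \<Longrightarrow> tensor i j (c + d) = tensor i j c + tensor i j d"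
  by (simp add: tensor_def lin_add)

text \<open>On the image of one factor the other coordinate is evaluated at the identity. This gives
  0 only modulo \<open>m\<close>, because the coordinates are additive only modulo
  \<open>m\<close>.\<close>

lemma tensor_push_i:
  assumes "i < r" "j < s"
  shows "a \<in> chains G 2 \<Longrightarrow> [tensor i j (push i1 a) = 0] (mod int m)"
    and "b \<in> chains H 2 \<Longrightarrow> [tensor i j (push i2 b) = 0] (mod int m)"
proof -
  assume a: "a \<in> chains G 2"
  have "tensor i j (push i1 a) \<in> {k. int m dvd k}" unfolding tensor_def lin_push
    by (rule lin_in_asub[OF dvd_subgroup], erule chains2E[OF a])
      (use beta_one[OF assms(2)] in \<open>simp add: cong_0_iff\<close>)
  then show "[tensor i j (push i1 a) = 0] (mod int m)" by (simp add: cong_0_iff)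
next
  assume b: "b \<in> chains H 2"
  have "tensor i j (push i2 b) \<in> {k. int m dvd k}" unfolding tensor_def lin_push
    by (rule lin_in_asub[OF dvd_subgroup], erule chains2E[OF b])
      (use alpha_one[OF assms(1)] in \<open>simp add: cong_0_iff\<close>)
  then show "[tensor i j (push i2 b) = 0] (mod int m)" by (simp add: cong_0_iff)
qed

lemma tensor_pairing:
  assumes "i < r" "j < s" "k < r" "l < s"
  shows "[tensor i j (pairing (f l) (e k)) = (if i = k \<and> j = l then 1 else 0)] (mod int m)"
proof -
  \<comment> \<open>The subtracted term comes from the swapped half of the commutator chain, where
    each projection meets the factor it kills.\<close>
  have "tensor i j (pairing (f l) (e k)) = \<beta> j (f l) * \<alpha> i (e k) - \<beta> j \<one>\<^bsub>H\<^esub> * \<alpha> i \<one>\<^bsub>G\<^esub>"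
    using assms by (simp add: tensor_def commutator_chain_def lin_diff)
  also have "[\<dots> = (if j = l then 1 else 0) * (if i = k then 1 else 0) - 0 * 0] (mod int m)"
    using assms by (intro cong_diff cong_mult alpha_e beta_f alpha_one beta_one)
  finally show ?thesis by (simp split: if_splits)
qed

lemma push_i [simp]:
  "a \<in> chains G 2 \<Longrightarrow> push p1 (push i1 a) = a" "b \<in> chains H 2 \<Longrightarrow> push p2 (push i2 b) = b"
proof -
  assume a: "a \<in> chains G 2"
  then have "push p1 (push i1 a) = lin single a"
    unfolding push_push unfolding push_def by (intro lin_cong) (auto elim: chains2E)
  then show "push p1 (push i1 a) = a" using a by (simp add: lin_singles chainsD(1))
next
  assume b: "b \<in> chains H 2"
  then have "push p2 (push i2 b) = lin single b"
    unfolding push_push unfolding push_def by (intro lin_cong) (auto elim: chains2E)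
  then show "push p2 (push i2 b) = b" using b by (simp add: lin_singles chainsD(1))
qed

text \<open>Every basis element goes to \<open>[1|1]\<close>, and the coefficients of a cycle sum to
  zero, so the image vanishes on the nose and not merely modulo boundaries.\<close>

lemma push_i_cross [simp]:
  "b \<in> cycles2 H \<Longrightarrow> push p1 (push i2 b) = 0" "a \<in> cycles2 G \<Longrightarrow> push p2 (push i1 a) = 0"
proof -
  assume b: "b \<in> cycles2 H"
  then have "push p1 (push i2 b) = lin (\<lambda>x. of_int 1 * single [\<one>\<^bsub>G\<^esub>, \<one>\<^bsub>G\<^esub>]) b"
    unfolding push_push unfolding push_def by (intro lin_cong) (auto simp: cycles2_iff elim: chains2E)
  then show "push p1 (push i2 b) = 0"
    using sum_of_cycle[OF b] unfolding lin_mult_fun by simp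
next
  assume a: "a \<in> cycles2 G"
  then have "push p2 (push i1 a) = lin (\<lambda>x. of_int 1 * single [\<one>\<^bsub>H\<^esub>, \<one>\<^bsub>H\<^esub>]) a"
    unfolding push_push unfolding push_def by (intro lin_cong) (auto simp: cycles2_iff elim: chains2E)
  then show "push p2 (push i1 a) = 0"
    using sum_of_cycle[OF a] unfolding lin_mult_fun by simp
qed

text \<open>Each projection sends one of the two entries to the identity, which leaves the chain of
  \<open>single_one_swap_boundary\<close> up to sign.\<close>

lemma push_pairing:
  assumes "g \<in> carrier G" "h \<in> carrier H"
  shows "push p1 (pairing h g) \<in> boundaries2 G" "push p2 (pairing h g) \<in> boundaries2 H"
  using assms G.single_one_swap_boundary[of g] asub_uminus[OF boundaries2_subgroup H.single_one_swap_boundary[of h]]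
  by (simp_all add: push_def commutator_chain_def lin_diff)

text \<open>The surjectivity half of the Kuenneth formula: embed \<open>a\<close> and
  \<open>b\<close>, and prescribe the mixed coefficients by a combination of pairings of generators,
  which is dual to \<open>tensor\<close>. An index \<open>k\<close> below \<open>r * s\<close>
  encodes the pair \<open>(k div s, k mod s)\<close>.\<close>

lemma surjective:
  assumes a: "a \<in> cycles2 G" and b: "b \<in> cycles2 H"
  obtains c where "c \<in> cycles2 P" "push p1 c - a \<in> boundaries2 G" "push p2 c - b \<in> boundaries2 H"
    "\<And>k. k < r * s \<Longrightarrow> [tensor (k div s) (k mod s) c = t k] (mod int m)"
proof -
  let ?T = "\<lambda>k. pairing (f (k mod s)) (e (k div s))"
  let ?S = "\<Sum>k<r * s. of_int (t k) * ?T k"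
  let ?c = "(push i1 a + push i2 b) + ?S"
  have fin: "finsupp ?S" by (intro finsupp_sum finsupp_scale) simp
  have ab: "a \<in> chains G 2" "b \<in> chains H 2" using a b by (auto simp: cycles2_iff)
  have idx: "k div s < r" "k mod s < s" if "k < r * s" for k
    using that by (auto simp: less_mult_imp_div_less) (metis gr0I mod_less_divisor mult_0_right not_less0)
  have 1: "?c \<in> cycles2 P"
    using a b idx
    by (intro asub_add[OF cycles2_subgroup] push_cycle[OF i1] push_cycle[OF i2] asub_sum[OF cycles2_subgroup]
        asub_scale[OF cycles2_subgroup] commutator_chain_cycle) (simp_all add: i_commute)
  have S: "push p ?S = (\<Sum>k<r * s. of_int (t k) * push p (?T k))" for p :: "'p \<Rightarrow> 'w"
    unfolding push_def by (subst lin_sum) (simp_all add: lin_scale)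
  have "push p1 ?S \<in> boundaries2 G" "push p2 ?S \<in> boundaries2 H"
    unfolding S using idx
    by (auto intro!: asub_sum[OF boundaries2_subgroup] asub_scale[OF boundaries2_subgroup] push_pairing)
  then have 2: "push p1 ?c - a \<in> boundaries2 G" "push p2 ?c - b \<in> boundaries2 H"
    using a b ab fin by (simp_all add: push_add)
  have 3: "[tensor (k div s) (k mod s) ?c = t k] (mod int m)" if k: "k < r * s" for k
  proof -
    have eq: "k div s = l div s \<and> k mod s = l mod s \<longleftrightarrow> k = l" for l
      by (metis div_mult_mod_eq)
    have eq1: "tensor (k div s) (k mod s) ?c = tensor (k div s) (k mod s) (push i1 a) + tensor (k div s) (k mod s) (push i2 b)
        + (\<Sum>l<r * s. t l * tensor (k div s) (k mod s) (?T l))"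
      using fin by (simp add: tensor_add) (simp add: tensor_def lin_sum lin_scale)
    have "[tensor (k div s) (k mod s) (push i1 a) + tensor (k div s) (k mod s) (push i2 b)
      + (\<Sum>l<r * s. t l * tensor (k div s) (k mod s) (?T l)) = 0 + 0 + (\<Sum>l<r * s. t l * (if k div s = l div s \<and> k mod s = l mod s then 1 else 0))] (mod int m)"
    proof (intro cong_add cong_sum)
      show "[tensor (k div s) (k mod s) (push i1 a) = 0] (mod int m)"
        "[tensor (k div s) (k mod s) (push i2 b) = 0] (mod int m)"
        using idx[OF k] ab by (simp_all add: tensor_push_i)
      fix l assume "l \<in> {..<r * s}"
      then show "[t l * tensor (k div s) (k mod s) (?T l)
          = t l * (if k div s = l div s \<and> k mod s = l mod s then 1 else 0)] (mod int m)"
        using idx k by (intro cong_mult[OF cong_refl] tensor_pairing) simp_all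
    qed
    moreover have "0 + 0 + (\<Sum>l<r * s. t l * (if k div s = l div s \<and> k mod s = l mod s then 1 else 0)) = t k"
      unfolding eq using k by (simp add: if_distrib cong: if_cong)
    ultimately show ?thesis by (simp only: eq1)
  qed
  show ?thesis by (rule that[OF 1 2 3])
qed

theorem schur_multiplier_product:
  "schur_multiplier P \<cong> schur_multiplier G \<times>\<times> schur_multiplier H
     \<times>\<times> product_group {..<r * s} (\<lambda>_. integer_mod_group m)" (is "_ \<cong> ?K")
proof -
  \<comment> \<open>The Kuenneth map is defined on cycles; its kernel will be the boundaries, so the
    first isomorphism theorem gives the claim.\<close>
  define \<Phi> where "\<Phi> c = (homology_class G (push p1 c), homology_class H (push p2 c),
    \<lambda>k\<in>{..<r * s}. tensor (k div s) (k mod s) c mod int m)" for c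
  have idx: "k div s < r" "k mod s < s" if "k < r * s" for k
    using that by (auto simp: less_mult_imp_div_less) (metis gr0I mod_less_divisor mult_0_right not_less0)
  have K: "group ?K"
    by (intro DirProd_group G.group_schur_multiplier H.group_schur_multiplier product_group) simp
  have Z: "group (cycles2_group P)" using comm_group_cycles2 by (rule comm_group.axioms(2))
  have \<Phi>: "\<Phi> \<in> hom (cycles2_group P) ?K"
  proof (rule homI)
    fix c assume c: "c \<in> carrier (cycles2_group P)"
    then show "\<Phi> c \<in> carrier ?K"
      using m push_cycle[OF p1] push_cycle[OF p2] hom_in_carrier[OF G.homology_class_hom] hom_in_carrier[OF H.homology_class_hom]
      by (auto simp: \<Phi>_def carrier_integer_mod_group)
    fix d assume d: "d \<in> carrier (cycles2_group P)"
    have fin: "finsupp c" "finsupp d" using c d by (auto simp: cycles2_iff dest: chainsD(1))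
    show "\<Phi> (c \<otimes>\<^bsub>cycles2_group P\<^esub> d) = \<Phi> c \<otimes>\<^bsub>?K\<^esub> \<Phi> d"
      using c d fin push_cycle[OF p1] push_cycle[OF p2] hom_mult[OF G.homology_class_hom] hom_mult[OF H.homology_class_hom]
      by (auto simp: \<Phi>_def push_add tensor_add mod_simps fun_eq_iff restrict_def)
  qed
  interpret \<Phi>: group_hom "cycles2_group P" ?K \<Phi>
    using Z K \<Phi> by (simp add: group_hom_def group_hom_axioms_def)
  have "kernel (cycles2_group P) ?K \<Phi> = boundaries2 P"
  proof -
    have "\<Phi> c = \<one>\<^bsub>?K\<^esub> \<longleftrightarrow> c \<in> boundaries2 P" if c: "c \<in> cycles2 P" for c
    proof -
      have "\<Phi> c = \<one>\<^bsub>?K\<^esub> \<longleftrightarrow> push p1 c \<in> boundaries2 G \<and> push p2 c \<in> boundaries2 H \<and>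
          (\<forall>k<r * s. int m dvd tensor (k div s) (k mod s) c)"
        using push_cycle[OF p1 c] push_cycle[OF p2 c]
        by (auto simp: \<Phi>_def G.homology_class_eq_one H.homology_class_eq_one fun_eq_iff restrict_def)
      moreover have "(\<forall>k<r * s. int m dvd tensor (k div s) (k mod s) c) \<longleftrightarrow> (\<forall>i<r. \<forall>j<s. int m dvd tensor i j c)"
      proof (intro iffI allI impI)
        fix i j assume *: "\<forall>k<r * s. int m dvd tensor (k div s) (k mod s) c" "i < r" "j < s"
        \<comment> \<open>The pair \<open>(i, j)\<close> is decoded from the index
          \<open>i * s + j\<close>.\<close>
        then have "i * s + j < Suc i * s" by simp
        also have "\<dots> \<le> r * s" using * by (intro mult_right_mono) auto
        finally show "int m dvd tensor i j c" using *(1)[rule_format, of "i * s + j"] *(3) by simp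
      qed (use idx in blast)
      ultimately show ?thesis using boundary_iff[OF c] by simp
    qed
    then show ?thesis using P.boundaries2_subset_cycles2 by (auto simp: kernel_def)
  qed
  moreover have "\<Phi> ` carrier (cycles2_group P) = carrier ?K"
  proof (rule antisym)
    show "\<Phi> ` carrier (cycles2_group P) \<subseteq> carrier ?K" using \<Phi>.hom_closed by blast
    show "carrier ?K \<subseteq> \<Phi> ` carrier (cycles2_group P)"
    proof
      fix z assume "z \<in> carrier ?K"
      then obtain x y t where z: "z = (x, y, t)" "x \<in> carrier (schur_multiplier G)" "y \<in> carrier (schur_multiplier H)"
        and t: "t \<in> (\<Pi>\<^sub>E k\<in>{..<r * s}. {0..<int m})"
        using m by (auto simp: carrier_integer_mod_group)
      obtain a b where ab: "a \<in> cycles2 G" "x = homology_class G a" "b \<in> cycles2 H" "y = homology_class H b"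
        using z G.homology_class_surj H.homology_class_surj by meson
      obtain c where c: "c \<in> cycles2 P" "push p1 c - a \<in> boundaries2 G" "push p2 c - b \<in> boundaries2 H"
        "\<And>k. k < r * s \<Longrightarrow> [tensor (k div s) (k mod s) c = t k] (mod int m)"
        using surjective[OF ab(1,3), of t] by blast
      \<comment> \<open>The values of \<open>t\<close> lie in \<open>{0..<int m}\<close>, so
        congruence gives equality of canonical residues.\<close>
      have "tensor (k div s) (k mod s) c mod int m = t k" if "k < r * s" for k
        using c(4)[OF that] PiE_mem[OF t, of k] that by (simp add: cong_def)
      then have "(\<lambda>k\<in>{..<r * s}. tensor (k div s) (k mod s) c mod int m) = t"
        using t by (intro ext) (auto simp: restrict_def PiE_def extensional_def)
      then have "\<Phi> c = z"
        using c ab z G.homology_class_eqI H.homology_class_eqI by (simp add: \<Phi>_def)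
      then show "z \<in> \<Phi> ` carrier (cycles2_group P)" using c by auto
    qed
  qed
  ultimately show ?thesis
    using \<Phi>.FactGroup_iso by (simp add: schur_multiplier_def)
qed

end

section \<open>Unitriangular groups\<close>

lemma (in abelian_monoid) finsum_swap:
  assumes "finite A" "finite B" "\<And>i j. i \<in> A \<Longrightarrow> j \<in> B \<Longrightarrow> f i j \<in> carrier G"
  shows "(\<Oplus>i\<in>A. \<Oplus>j\<in>B. f i j) = (\<Oplus>j\<in>B. \<Oplus>i\<in>A. f i j)"
  using assms(1,3)
proof (induction A rule: finite_induct)
  case (insert x A)
  have "(\<Oplus>i\<in>insert x A. \<Oplus>j\<in>B. f i j) = (\<Oplus>j\<in>B. f x j) \<oplus> (\<Oplus>j\<in>B. \<Oplus>i\<in>A. f i j)"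
    using insert by (subst finsum_insert) (auto intro!: finsum_closed)
  also have "\<dots> = (\<Oplus>j\<in>B. f x j \<oplus> (\<Oplus>i\<in>A. f i j))"
    using insert by (intro finsum_addf[symmetric]) (auto intro!: finsum_closed)
  also have "\<dots> = (\<Oplus>j\<in>B. \<Oplus>i\<in>insert x A. f i j)"
    using insert by (intro finsum_cong') (auto intro!: finsum_closed finsum_insert[symmetric])
  finally show ?case .
qed (simp add: finsum_zero)

text \<open>Collapses the entry of a product of sparse matrices to its few nonzero terms.\<close>

lemma (in abelian_monoid) finsum_support:
  assumes "finite A" "S \<subseteq> A" "\<And>i. i \<in> A - S \<Longrightarrow> f i = \<zero>" "f \<in> S \<rightarrow> carrier G"
  shows "finsum G f A = finsum G f S"
  using assms by (intro add.finprod_mono_neutral_cong_right) auto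

lemma UT_mult: "(A \<otimes>\<^bsub>UT n R\<^esub> B) i j =
    (if i < n \<and> j < n then finsum R (\<lambda>k. A i k \<otimes>\<^bsub>R\<^esub> B k j) {..<n} else \<zero>\<^bsub>R\<^esub>)"
  by (simp add: UT_def)

lemma UT_one: "\<one>\<^bsub>UT n R\<^esub> i j = (if i < n \<and> j < n \<and> i = j then \<one>\<^bsub>R\<^esub> else \<zero>\<^bsub>R\<^esub>)"
  by (simp add: UT_def)

text \<open>The transvection with entry \<open>a\<close> at \<open>(i, j)\<close>. The diagonal ones
  stop at \<open>n\<close>, since elements of \<open>UT n R\<close> are zero outside the n by n
  block.\<close>

definition elem_mat :: "nat \<Rightarrow> ('a, 'b) ring_scheme \<Rightarrow> nat \<Rightarrow> nat \<Rightarrow> 'a \<Rightarrow> nat \<Rightarrow> nat \<Rightarrow> 'a" where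
  "elem_mat n R i j a = (\<lambda>k l. if k = l \<and> k < n then \<one>\<^bsub>R\<^esub> else if k = i \<and> l = j then a else \<zero>\<^bsub>R\<^esub>)"

context ring
begin

lemma UT_entry:
  assumes "A \<in> carrier (UT n R)"
  shows "A i j \<in> carrier R" "j < i \<Longrightarrow> A i j = \<zero>" "i < n \<Longrightarrow> A i i = \<one>" "\<not> i < n \<Longrightarrow> A i j = \<zero>" "\<not> j < n \<Longrightarrow> A i j = \<zero>"
proof -
  have 1: "\<And>i j. (i < n \<and> j < n \<longrightarrow> A i j \<in> carrier R) \<and> (i < n \<and> j < i \<longrightarrow> A i j = \<zero>) \<and> (i < n \<longrightarrow> A i i = \<one>) \<and>
         (\<not> (i < n \<and> j < n) \<longrightarrow> A i j = \<zero>)" using assms by (simp add: UT_def)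
  show "A i j \<in> carrier R" using 1[of i j] by (cases "i < n \<and> j < n") auto
  show "j < i \<Longrightarrow> A i j = \<zero>" using 1[of i j] by (cases "i < n") auto
qed (use assms in \<open>simp_all add: UT_def\<close>)

lemma UT_carrierI:
  assumes "\<And>i j. i < j \<Longrightarrow> j < n \<Longrightarrow> A i j \<in> carrier R" "\<And>i j. i < n \<Longrightarrow> j < i \<Longrightarrow> A i j = \<zero>"
    "\<And>i. i < n \<Longrightarrow> A i i = \<one>" "\<And>i j. \<not> (i < n \<and> j < n) \<Longrightarrow> A i j = \<zero>"
  shows "A \<in> carrier (UT n R)"
proof -
  have "A i j \<in> carrier R" if "i < n" "j < n" for i j
    using that assms(1)[of i j] assms(2)[of i j] assms(3)[of i] by (cases i j rule: linorder_cases) auto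
  then show ?thesis
    unfolding UT_def partial_object.simps mem_Collect_eq using assms(2-4) by blast
qed

lemma UT_mult_closed [simp]:
  assumes A: "A \<in> carrier (UT n R)" and B: "B \<in> carrier (UT n R)"
  shows "A \<otimes>\<^bsub>UT n R\<^esub> B \<in> carrier (UT n R)"
proof (rule UT_carrierI)
  note [simp] = UT_entry[OF A] UT_entry[OF B]
  fix i j :: nat assume "i < n" "j < i"
  then have "A i k \<otimes> B k j = \<zero>" for k
    by (cases "k < i") auto
  then show "(A \<otimes>\<^bsub>UT n R\<^esub> B) i j = \<zero>" by (simp add: UT_mult)
next
  note [simp] = UT_entry[OF A] UT_entry[OF B]
  fix i assume "i < n"
  moreover have "A i k \<otimes> B k i = \<zero>" if "k \<noteq> i" for k
    using that by (cases "k < i") auto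
  ultimately have "(A \<otimes>\<^bsub>UT n R\<^esub> B) i i = (\<Oplus>k\<in>{i}. A i k \<otimes> B k i)"
    unfolding UT_mult by (subst finsum_support[of "{..<n}" "{i}"]) auto
  then show "(A \<otimes>\<^bsub>UT n R\<^esub> B) i i = \<one>" using \<open>i < n\<close> by simp
qed (auto simp: UT_mult UT_entry[OF A] UT_entry[OF B])

lemma UT_one_closed [simp]: "\<one>\<^bsub>UT n R\<^esub> \<in> carrier (UT n R)"
  by (rule UT_carrierI) (auto simp: UT_one)

lemma UT_mult_assoc:
  assumes A: "A \<in> carrier (UT n R)" and B: "B \<in> carrier (UT n R)" and C: "C \<in> carrier (UT n R)"
  shows "(A \<otimes>\<^bsub>UT n R\<^esub> B) \<otimes>\<^bsub>UT n R\<^esub> C = A \<otimes>\<^bsub>UT n R\<^esub> (B \<otimes>\<^bsub>UT n R\<^esub> C)"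
proof (intro ext)
  fix i j
  note [simp] = UT_entry(1)[OF A] UT_entry(1)[OF B] UT_entry(1)[OF C]
  show "((A \<otimes>\<^bsub>UT n R\<^esub> B) \<otimes>\<^bsub>UT n R\<^esub> C) i j = (A \<otimes>\<^bsub>UT n R\<^esub> (B \<otimes>\<^bsub>UT n R\<^esub> C)) i j"
  proof (cases "i < n \<and> j < n")
    case True
    have "((A \<otimes>\<^bsub>UT n R\<^esub> B) \<otimes>\<^bsub>UT n R\<^esub> C) i j
        = (\<Oplus>k\<in>{..<n}. (\<Oplus>l\<in>{..<n}. A i l \<otimes> B l k) \<otimes> C k j)"
      using True by (simp add: UT_mult[of n R _ C], intro finsum_cong') (auto simp: UT_mult)
    also have "\<dots> = (\<Oplus>k\<in>{..<n}. \<Oplus>l\<in>{..<n}. A i l \<otimes> (B l k \<otimes> C k j))"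
      by (intro finsum_cong') (auto simp: finsum_ldistr m_assoc)
    also have "\<dots> = (\<Oplus>l\<in>{..<n}. \<Oplus>k\<in>{..<n}. A i l \<otimes> (B l k \<otimes> C k j))"
      by (rule finsum_swap) auto
    also have "\<dots> = (\<Oplus>l\<in>{..<n}. A i l \<otimes> (\<Oplus>k\<in>{..<n}. B l k \<otimes> C k j))"
      by (intro finsum_cong') (auto simp: finsum_rdistr)
    also have "\<dots> = (A \<otimes>\<^bsub>UT n R\<^esub> (B \<otimes>\<^bsub>UT n R\<^esub> C)) i j"
      using True by (simp add: UT_mult[of n R A], intro finsum_cong') (auto simp: UT_mult)
    finally show ?thesis .
  qed (auto simp: UT_mult)
qed

lemma elem_mat_closed [simp]: "i < j \<Longrightarrow> j < n \<Longrightarrow> a \<in> carrier R \<Longrightarrow> elem_mat n R i j a \<in> carrier (UT n R)"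
  by (rule UT_carrierI) (auto simp: elem_mat_def)

text \<open>A column operation: column \<open>l\<close> of the elementary matrix has a single
  nonzero row, or at most two when \<open>l = j\<close>. \<open>elem_mat_mult_UT\<close> is the
  corresponding row operation.\<close>

lemma UT_mult_elem_mat:
  assumes A [simp]: "A \<in> carrier (UT n R)" and ij: "i < j" "j < n" and a [simp]: "a \<in> carrier R"
  shows "A \<otimes>\<^bsub>UT n R\<^esub> elem_mat n R i j a = (\<lambda>k l. if l = j then A k j \<oplus> A k i \<otimes> a else A k l)"
proof (intro ext)
  fix k l
  note [simp] = UT_entry[OF A]
  let ?f = "\<lambda>p. A k p \<otimes> elem_mat n R i j a p l"
  show "(A \<otimes>\<^bsub>UT n R\<^esub> elem_mat n R i j a) k l = (if l = j then A k j \<oplus> A k i \<otimes> a else A k l)"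
  proof (cases "k < n \<and> l < n")
    case True
    then have "finsum R ?f {..<n} = finsum R ?f (if l = j then {i, j} else {l})"
      using ij by (intro finsum_support) (auto simp: elem_mat_def split: if_splits)
    then show ?thesis using True ij by (auto simp: UT_mult elem_mat_def a_comm)
  qed (use ij in \<open>auto simp: UT_mult\<close>)
qed

lemma elem_mat_mult_UT:
  assumes A [simp]: "A \<in> carrier (UT n R)" and ij: "i < j" "j < n" and a [simp]: "a \<in> carrier R"
  shows "elem_mat n R i j a \<otimes>\<^bsub>UT n R\<^esub> A = (\<lambda>k l. if k = i then A i l \<oplus> a \<otimes> A j l else A k l)"
proof (intro ext)
  fix k l
  note [simp] = UT_entry[OF A]
  let ?f = "\<lambda>p. elem_mat n R i j a k p \<otimes> A p l"
  show "(elem_mat n R i j a \<otimes>\<^bsub>UT n R\<^esub> A) k l = (if k = i then A i l \<oplus> a \<otimes> A j l else A k l)"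
  proof (cases "k < n \<and> l < n")
    case True
    then have "finsum R ?f {..<n} = finsum R ?f (if k = i then {i, j} else {k})"
      using ij by (intro finsum_support) (auto simp: elem_mat_def split: if_splits)
    then show ?thesis using True ij by (auto simp: UT_mult elem_mat_def)
  qed (use ij in \<open>auto simp: UT_mult\<close>)
qed

lemma elem_mat_zero: "i < j \<Longrightarrow> elem_mat n R i j \<zero> = \<one>\<^bsub>UT n R\<^esub>"
  by (auto simp: fun_eq_iff elem_mat_def UT_one)

lemma elem_mat_add:
  assumes "i < j" "j < n" "a \<in> carrier R" "b \<in> carrier R"
  shows "elem_mat n R i j a \<otimes>\<^bsub>UT n R\<^esub> elem_mat n R i j b = elem_mat n R i j (a \<oplus> b)"
  unfolding UT_mult_elem_mat[OF elem_mat_closed[OF assms(1-3)] assms(1,2,4)]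
  using assms by (auto simp: fun_eq_iff elem_mat_def)

text \<open>The Steinberg relation for transvections, written without inverses because
  \<open>UT n R\<close> is not yet known to be a group.\<close>

lemma elem_mat_commutator:
  assumes "i < k" "k < j" "j < n" "a \<in> carrier R"
  shows "elem_mat n R i k a \<otimes>\<^bsub>UT n R\<^esub> elem_mat n R k j \<one>
       = elem_mat n R i j a \<otimes>\<^bsub>UT n R\<^esub> (elem_mat n R k j \<one> \<otimes>\<^bsub>UT n R\<^esub> elem_mat n R i k a)"
proof -
  have carr: "elem_mat n R i k a \<in> carrier (UT n R)" "elem_mat n R k j \<one> \<in> carrier (UT n R)"
    using assms by auto
  have lt: "i < j" "k < n" using assms by auto
  show ?thesis
    unfolding elem_mat_mult_UT[OF UT_mult_closed[OF carr(2,1)] lt(1) assms(3,4)]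
    unfolding UT_mult_elem_mat[OF carr(1) assms(2,3) one_closed] UT_mult_elem_mat[OF carr(2) assms(1) lt(2) assms(4)]
    using assms by (auto simp: fun_eq_iff elem_mat_def)
qed

text \<open>Clear the first nontrivial column entry by entry: as long as all earlier columns are trivial,
  right multiplication by an elementary matrix changes a single entry.\<close>
lemma UT_induct [consumes 1, case_names one elem]:
  assumes "A \<in> carrier (UT n R)" and one: "Q \<one>\<^bsub>UT n R\<^esub>"
    and elem: "\<And>A i j a. A \<in> carrier (UT n R) \<Longrightarrow> Q A \<Longrightarrow> i < j \<Longrightarrow> j < n \<Longrightarrow> a \<in> carrier R \<Longrightarrow>
      Q (A \<otimes>\<^bsub>UT n R\<^esub> elem_mat n R i j a)"
  shows "Q A"
proof -
  define D where "D A = {(i, j). i < j \<and> j < n \<and> A i j \<noteq> \<zero>}" for A :: "nat \<Rightarrow> nat \<Rightarrow> 'a"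
  have fin: "finite (D A)" for A
    by (rule finite_subset[of _ "{..<n} \<times> {..<n}"]) (auto simp: D_def)
  show ?thesis using assms(1)
  proof (induction "card (D A)" arbitrary: A rule: less_induct)
    case (less A)
    note A = less.prems
    note [simp] = UT_entry[OF A]
    show ?case
    proof (cases "D A = {}")
      case True
      have "A i j = \<one>\<^bsub>UT n R\<^esub> i j" for i j
        using True by (cases i j rule: linorder_cases) (cases "j < n"; auto simp: D_def UT_one)+
      then have "A = \<one>\<^bsub>UT n R\<^esub>" by (intro ext)
      then show ?thesis using one by simp
    next
      case False
      define j where "j = (LEAST j. \<exists>i. (i, j) \<in> D A)"
      obtain i where ij: "(i, j) \<in> D A"
        using LeastI_ex[of "\<lambda>j. \<exists>i. (i, j) \<in> D A"] False unfolding j_def by auto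
      have triv: "A k l = \<zero>" if "k < l" "l < j" for k l
      proof (rule ccontr)
        assume "A k l \<noteq> \<zero>"
        then have "(k, l) \<in> D A" using that ij by (auto simp: D_def)
        then show False using not_less_Least[of l] that(2) unfolding j_def by blast
      qed
      have lt: "i < j" "j < n" using ij by (auto simp: D_def)
      define A' where "A' = (\<lambda>k l. if k = i \<and> l = j then \<zero> else A k l)"
      have A' [simp]: "A' \<in> carrier (UT n R)"
        using lt by (intro UT_carrierI) (auto simp: A'_def)
      have "D A' \<subset> D A" using ij by (auto simp: D_def A'_def)
      then have Q: "Q A'" using less.hyps[OF psubset_card_mono[OF fin]] by simp
      have col: "A k i = (if k = i then \<one> else \<zero>)" for k
        using triv[of k i] lt by (cases k i rule: linorder_cases) auto
      have eq: "A = A' \<otimes>\<^bsub>UT n R\<^esub> elem_mat n R i j (A i j)"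
        unfolding UT_mult_elem_mat[OF A' lt UT_entry(1)[OF A]]
        using lt by (auto simp: fun_eq_iff A'_def col)
      show ?thesis by (subst eq) (rule elem[OF A' Q lt UT_entry(1)[OF A]])
    qed
  qed
qed

text \<open>Left inverses suffice. They are built along \<open>UT_induct\<close>, each new
  elementary factor on the right being cancelled by its inverse on the left.\<close>

lemma UT_group: "group (UT n R)"
proof (rule groupI)
  show "\<one>\<^bsub>UT n R\<^esub> \<otimes>\<^bsub>UT n R\<^esub> A = A" if A: "A \<in> carrier (UT n R)" for A
  proof (intro ext)
    fix i j
    note [simp] = UT_entry[OF A]
    have "finsum R (\<lambda>k. \<one>\<^bsub>UT n R\<^esub> i k \<otimes> A k j) {..<n} = finsum R (\<lambda>k. \<one>\<^bsub>UT n R\<^esub> i k \<otimes> A k j) {i}" if "i < n"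
      using that by (intro finsum_support) (auto simp: UT_one)
    then show "(\<one>\<^bsub>UT n R\<^esub> \<otimes>\<^bsub>UT n R\<^esub> A) i j = A i j" by (auto simp: UT_mult UT_one)
  qed
  note l_one = this
  show "\<exists>B\<in>carrier (UT n R). B \<otimes>\<^bsub>UT n R\<^esub> A = \<one>\<^bsub>UT n R\<^esub>" if "A \<in> carrier (UT n R)" for A
    using that
  proof (induction rule: UT_induct)
    case one
    show ?case using l_one[OF UT_one_closed] by (intro bexI[of _ "\<one>\<^bsub>UT n R\<^esub>"]) simp_all
  next
    case (elem A i j a)
    then obtain B where B: "B \<in> carrier (UT n R)" "B \<otimes>\<^bsub>UT n R\<^esub> A = \<one>\<^bsub>UT n R\<^esub>" by auto
    have "(elem_mat n R i j (\<ominus> a) \<otimes>\<^bsub>UT n R\<^esub> B) \<otimes>\<^bsub>UT n R\<^esub> (A \<otimes>\<^bsub>UT n R\<^esub> elem_mat n R i j a)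
        = elem_mat n R i j (\<ominus> a) \<otimes>\<^bsub>UT n R\<^esub> ((B \<otimes>\<^bsub>UT n R\<^esub> A) \<otimes>\<^bsub>UT n R\<^esub> elem_mat n R i j a)"
      using elem B(1) by (simp add: UT_mult_assoc)
    also have "\<dots> = \<one>\<^bsub>UT n R\<^esub>"
      using elem by (simp add: B(2) l_one elem_mat_add l_neg elem_mat_zero)
    finally show ?case using elem B(1) by (intro bexI[of _ "elem_mat n R i j (\<ominus> a) \<otimes>\<^bsub>UT n R\<^esub> B"]) simp_all
  qed
qed (simp_all add: UT_mult_assoc)

text \<open>No index lies strictly between \<open>i\<close> and \<open>Suc i\<close>, so
  triangularity leaves only the two terms containing a diagonal entry. Superdiagonal entries thus
  give homomorphisms to the additive group.\<close>

lemma UT_superdiagonal_mult: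
  assumes A: "A \<in> carrier (UT n R)" and B: "B \<in> carrier (UT n R)" and i: "Suc i < n"
  shows "(A \<otimes>\<^bsub>UT n R\<^esub> B) i (Suc i) = A i (Suc i) \<oplus> B i (Suc i)"
proof -
  note [simp] = UT_entry[OF A] UT_entry[OF B]
  have "A i k \<otimes> B k (Suc i) = \<zero>" if "k \<noteq> i" "k \<noteq> Suc i" for k
    using that by (cases "k < i"; cases "Suc i < k") auto
  then have "(A \<otimes>\<^bsub>UT n R\<^esub> B) i (Suc i) = (\<Oplus>k\<in>{i, Suc i}. A i k \<otimes> B k (Suc i))"
    using i unfolding UT_mult by (subst finsum_support[of "{..<n}" "{i, Suc i}"]) auto
  then show ?thesis using i by (simp add: a_comm)
qed

end

section \<open>The abelianization of the unitriangular group over the integers modulo m\<close>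

context
  fixes m n :: nat
  assumes m: "m > 1"
begin

interpretation residues "int m" "residue_ring (int m)"
  using m by unfold_locales auto

abbreviation "UTm \<equiv> UT n (residue_ring (int m))"
abbreviation "Em i j \<equiv> elem_mat n (residue_ring (int m)) i j"

lemma UT_residue_superdiagonal_mult:
  assumes "A \<in> carrier UTm" "B \<in> carrier UTm" "Suc i < n"
  shows "[(A \<otimes>\<^bsub>UTm\<^esub> B) i (Suc i) = A i (Suc i) + B i (Suc i)] (mod int m)"
  using UT_superdiagonal_mult[OF assms] by (simp add: res_add_eq cong_def)

context
  fixes B :: "'a::comm_ring_1 set" and \<phi> :: "(nat \<Rightarrow> nat \<Rightarrow> int) \<Rightarrow> 'a"
  assumes B: "additive_subgroup_of B"
    and \<phi>: "\<And>x y. x \<in> carrier UTm \<Longrightarrow> y \<in> carrier UTm \<Longrightarrow> \<phi> (x \<otimes>\<^bsub>UTm\<^esub> y) - (\<phi> x + \<phi> y) \<in> B"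
begin

lemma hom_UT_one: "\<phi> \<one>\<^bsub>UTm\<^esub> \<in> B"
proof -
  interpret U: group UTm by (rule UT_group)
  show ?thesis using asub_uminus[OF B \<phi>[of "\<one>\<^bsub>UTm\<^esub>" "\<one>\<^bsub>UTm\<^esub>"]] by simp
qed

text \<open>The multiplier \<open>k\<close> is not restricted to be below \<open>m\<close>: the case
  \<open>k = m\<close>, where the elementary matrix is trivial, yields the torsion relation.\<close>

lemma hom_UT_elem_multiple:
  assumes "i < j" "j < n"
  shows "\<phi> (Em i j (int k mod int m)) - of_int (int k) * \<phi> (Em i j 1) \<in> B"
proof (induction k)
  case 0
  then show ?case using hom_UT_one elem_mat_zero[OF assms(1)] by (simp add: res_zero_eq)
next
  case (Suc k)
  have carr: "int k mod int m \<in> carrier (residue_ring (int m))" "1 \<in> carrier (residue_ring (int m))"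
    using m by (auto simp: res_carrier_eq)
  have "Em i j (int k mod int m) \<otimes>\<^bsub>UTm\<^esub> Em i j 1 = Em i j (int (Suc k) mod int m)"
    using elem_mat_add[OF assms carr] by (simp add: res_add_eq mod_simps add.commute)
  then have "\<phi> (Em i j (int (Suc k) mod int m)) - (\<phi> (Em i j (int k mod int m)) + \<phi> (Em i j 1)) \<in> B"
    using \<phi>[of "Em i j (int k mod int m)" "Em i j 1"] assms carr by simp
  from asub_add[OF B this Suc] show ?case by (simp add: algebra_simps)
qed

lemma hom_UT_elem_torsion:
  assumes "i < j" "j < n"
  shows "of_int (int m) * \<phi> (Em i j 1) \<in> B"
  using asub_diff[OF B hom_UT_one hom_UT_elem_multiple[OF assms, of m]] elem_mat_zero[OF assms(1), of n]
  by (simp add: res_zero_eq)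

text \<open>Beyond the superdiagonal an elementary matrix is a commutator, by
  \<open>elem_mat_commutator\<close> with middle index \<open>Suc i\<close>, and so dies in every
  abelian quotient.\<close>

lemma hom_UT_elem_far:
  assumes "Suc i < j" "j < n" "a \<in> carrier (residue_ring (int m))"
  shows "\<phi> (Em i j a) \<in> B"
proof -
  let ?x = "Em i (Suc i) a" and ?y = "Em (Suc i) j 1" and ?z = "Em i j a"
  have one: "1 \<in> carrier (residue_ring (int m))" "\<one>\<^bsub>residue_ring (int m)\<^esub> = 1"
    using m by (auto simp: res_carrier_eq res_one_eq)
  have carr: "?x \<in> carrier UTm" "?y \<in> carrier UTm" "?z \<in> carrier UTm" "?y \<otimes>\<^bsub>UTm\<^esub> ?x \<in> carrier UTm"
    using assms one by simp_all
  have "?x \<otimes>\<^bsub>UTm\<^esub> ?y = ?z \<otimes>\<^bsub>UTm\<^esub> (?y \<otimes>\<^bsub>UTm\<^esub> ?x)"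
    using elem_mat_commutator[of i "Suc i" j n a] assms one by simp
  then have "\<phi> (?z \<otimes>\<^bsub>UTm\<^esub> (?y \<otimes>\<^bsub>UTm\<^esub> ?x)) - (\<phi> ?x + \<phi> ?y) \<in> B"
    using \<phi>[OF carr(1,2)] by simp
  from asub_diff[OF B asub_diff[OF B this \<phi>[OF carr(3,4)]] \<phi>[OF carr(2,1)]]
  show ?thesis by (simp add: algebra_simps)
qed

text \<open>By \<open>UT_induct\<close> it is enough to follow elementary factors: those on the
  superdiagonal contribute multiples of the generators, all others nothing.\<close>

lemma hom_UT_superdiagonal:
  assumes "A \<in> carrier UTm"
  shows "\<phi> A - (\<Sum>i<n - 1. of_int (A i (Suc i)) * \<phi> (Em i (Suc i) 1)) \<in> B"
  using assms
proof (induction rule: UT_induct)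
  case one
  have "(\<Sum>i<n - 1. of_int (\<one>\<^bsub>UTm\<^esub> i (Suc i)) * \<phi> (Em i (Suc i) 1)) = 0"
    by (simp add: UT_one res_zero_eq)
  then show ?case using hom_UT_one by simp
next
  case (elem A i j a)
  let ?X = "Em i j a" and ?e = "\<lambda>l. \<phi> (Em l (Suc l) 1)"
  have X: "?X \<in> carrier UTm" using elem by simp
  have 1: "\<phi> ?X - (\<Sum>l<n - 1. of_int (?X l (Suc l)) * ?e l) \<in> B"
  proof (cases "j = Suc i")
    case True
    have "(\<Sum>l<n - 1. of_int (?X l (Suc l)) * ?e l) = (\<Sum>l<n - 1. if l = i then of_int a * ?e l else 0)"
      using True by (intro sum.cong) (auto simp: elem_mat_def res_zero_eq)
    also have "\<dots> = of_int a * ?e i" using True elem by simp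
    finally show ?thesis
      using hom_UT_elem_multiple[of i j "nat a"] True elem by (simp add: res_carrier_eq)
  next
    case False
    have "(\<Sum>l<n - 1. of_int (?X l (Suc l)) * ?e l) = 0"
      using False by (intro sum.neutral) (auto simp: elem_mat_def res_zero_eq)
    then show ?thesis using hom_UT_elem_far[of i j a] False elem by simp
  qed
  have "of_int ((A \<otimes>\<^bsub>UTm\<^esub> ?X) l (Suc l)) * ?e l - (of_int (A l (Suc l)) * ?e l + of_int (?X l (Suc l)) * ?e l) \<in> B"
    if l: "l < n - 1" for l
  proof -
    have "[(A \<otimes>\<^bsub>UTm\<^esub> ?X) l (Suc l) = A l (Suc l) + ?X l (Suc l)] (mod int m)"
      using l by (intro UT_residue_superdiagonal_mult elem X) simp
    \<comment> \<open>Entries are integer representatives, additive only up to a multiple of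
      \<open>m\<close>; the torsion of the generators absorbs this discrepancy.\<close>
    then obtain q where "(A \<otimes>\<^bsub>UTm\<^esub> ?X) l (Suc l) - (A l (Suc l) + ?X l (Suc l)) = q * int m"
      by (metis cong_iff_dvd_diff dvdE mult.commute)
    then have "(A \<otimes>\<^bsub>UTm\<^esub> ?X) l (Suc l) = A l (Suc l) + ?X l (Suc l) + q * int m" by simp
    moreover have "of_int q * (of_int (int m) * ?e l) \<in> B"
      using l by (intro asub_scale[OF B] hom_UT_elem_torsion) auto
    ultimately show ?thesis by (simp add: algebra_simps)
  qed
  then have 2: "(\<Sum>l<n - 1. of_int ((A \<otimes>\<^bsub>UTm\<^esub> ?X) l (Suc l)) * ?e l
      - (of_int (A l (Suc l)) * ?e l + of_int (?X l (Suc l)) * ?e l)) \<in> B"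
    by (intro asub_sum[OF B]) auto
  from asub_diff[OF B asub_add[OF B \<phi>[OF elem.hyps(1) X] asub_add[OF B elem.IH 1]] 2] show ?case
    by (simp add: sum_subtractf sum.distrib algebra_simps)
qed

end

end

section \<open>Unitriangular groups over a product ring\<close>

lemma RDirProd_simps:
  "carrier (RDirProd R S) = carrier R \<times> carrier S"
  "\<one>\<^bsub>RDirProd R S\<^esub> = (\<one>\<^bsub>R\<^esub>, \<one>\<^bsub>S\<^esub>)" "\<zero>\<^bsub>RDirProd R S\<^esub> = (\<zero>\<^bsub>R\<^esub>, \<zero>\<^bsub>S\<^esub>)"
  "x \<otimes>\<^bsub>RDirProd R S\<^esub> y = (fst x \<otimes>\<^bsub>R\<^esub> fst y, snd x \<otimes>\<^bsub>S\<^esub> snd y)"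
  "x \<oplus>\<^bsub>RDirProd R S\<^esub> y = (fst x \<oplus>\<^bsub>R\<^esub> fst y, snd x \<oplus>\<^bsub>S\<^esub> snd y)"
  by (simp_all add: RDirProd_def DirProd_def monoid.defs case_prod_beta)

lemma finsum_RDirProd:
  assumes "ring R" "ring S" "\<And>i. i \<in> A \<Longrightarrow> f i \<in> carrier (RDirProd R S)"
  shows "finsum (RDirProd R S) f A = (finsum R (\<lambda>i. fst (f i)) A, finsum S (\<lambda>i. snd (f i)) A)"
proof -
  interpret R: ring R by fact
  interpret S: ring S by fact
  interpret RS: ring "RDirProd R S" by (rule RDirProd_ring) fact+
  show ?thesis using assms(3)
  proof (induction A rule: infinite_finite_induct)
    case (insert x A)
    have "fst (f i) \<in> carrier R" "snd (f i) \<in> carrier S" if "i \<in> insert x A" for i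
      using insert.prems[OF that] by (auto simp: RDirProd_simps)
    then show ?case using insert by (simp add: RDirProd_simps)
  qed (simp_all add: RDirProd_simps)
qed

lemma UT_RDirProd_group_product:
  assumes R: "ring R" and S: "ring S"
  shows "group_product (UT n (RDirProd R S)) (UT n R) (UT n S)
    (\<lambda>A i j. fst (A i j)) (\<lambda>A i j. snd (A i j)) (\<lambda>A B i j. (A i j, B i j))"
proof -
  interpret R: ring R by fact
  interpret S: ring S by fact
  interpret RS: ring "RDirProd R S" by (rule RDirProd_ring) fact+
  let ?RS = "RDirProd R S"
  have entry: "fst (A i j) \<in> carrier R" "snd (A i j) \<in> carrier S" if "A \<in> carrier (UT n ?RS)" for A i j
    using RS.UT_entry(1)[OF that, of i j] by (auto simp: RDirProd_simps)
  have closed: "(\<lambda>i j. fst (A i j)) \<in> carrier (UT n R)" "(\<lambda>i j. snd (A i j)) \<in> carrier (UT n S)"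
    if "A \<in> carrier (UT n ?RS)" for A
  proof -
    note [simp] = entry[OF that] RS.UT_entry(2-5)[OF that]
    show "(\<lambda>i j. fst (A i j)) \<in> carrier (UT n R)"
      by (rule R.UT_carrierI) (auto simp: RDirProd_simps)
    show "(\<lambda>i j. snd (A i j)) \<in> carrier (UT n S)"
      by (rule S.UT_carrierI) (auto simp: RDirProd_simps)
  qed
  have mult: "(A \<otimes>\<^bsub>UT n ?RS\<^esub> B) i j =
      (((\<lambda>i j. fst (A i j)) \<otimes>\<^bsub>UT n R\<^esub> (\<lambda>i j. fst (B i j))) i j,
       ((\<lambda>i j. snd (A i j)) \<otimes>\<^bsub>UT n S\<^esub> (\<lambda>i j. snd (B i j))) i j)"
    if "A \<in> carrier (UT n ?RS)" "B \<in> carrier (UT n ?RS)" for A B i j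
    using RS.UT_entry(1)[OF that(1)] RS.UT_entry(1)[OF that(2)]
    by (simp add: UT_mult finsum_RDirProd[OF R S]) (simp add: RDirProd_simps)
  show ?thesis
    unfolding group_product_def group_product_axioms_def
  proof (intro conjI allI impI)
    show "group (UT n ?RS)" "group (UT n R)" "group (UT n S)"
      by (rule RS.UT_group R.UT_group S.UT_group)+
    show "(\<lambda>A i j. fst (A i j)) \<in> hom (UT n ?RS) (UT n R)"
      by (rule homI) (simp_all add: closed mult)
    show "(\<lambda>A i j. snd (A i j)) \<in> hom (UT n ?RS) (UT n S)"
      by (rule homI) (simp_all add: closed mult)
    fix A B assume "A \<in> carrier (UT n R)" "B \<in> carrier (UT n S)"
    note R.UT_entry[OF this(1), simp] S.UT_entry[OF this(2), simp]
    show "(\<lambda>i j. (A i j, B i j)) \<in> carrier (UT n ?RS)"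
      by (rule RS.UT_carrierI) (auto simp: RDirProd_simps)
  qed simp_all
qed

theorem mainTheorem11:
  fixes n m1 m2 :: nat
  assumes "n \<ge> 3" and "m1 \<ge> 2" and "m2 \<ge> 2" and "m1 dvd m2"
  shows "schur_multiplier (UT n (RDirProd (residue_ring (int m1)) (residue_ring (int m2))))
           \<cong> schur_multiplier (UT n (residue_ring (int m1)))
             \<times>\<times> schur_multiplier (UT n (residue_ring (int m2)))
             \<times>\<times> product_group {..<(n - 1) ^ 2} (\<lambda>_. integer_mod_group m1)"
proof -
  let ?R1 = "residue_ring (int m1)" and ?R2 = "residue_ring (int m2)"
  interpret R1: residues "int m1" ?R1 using assms by unfold_locales auto
  interpret R2: residues "int m2" ?R2 using assms by unfold_locales auto
  interpret group_product "UT n (RDirProd ?R1 ?R2)" "UT n ?R1" "UT n ?R2"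
    "\<lambda>A i j. fst (A i j)" "\<lambda>A i j. snd (A i j)" "\<lambda>A B i j. (A i j, B i j)"
    by (rule UT_RDirProd_group_product) (rule R1.ring_axioms R2.ring_axioms)+
  let ?\<alpha> = "\<lambda>i A. A i (Suc i) :: int"
  have m: "m1 > 1" "m2 > 1" using assms by auto
  have one: "1 \<in> carrier ?R1" "1 \<in> carrier ?R2" using m by (auto simp: R1.res_carrier_eq R2.res_carrier_eq)
  \<comment> \<open>The superdiagonal entries are the \<open>n - 1\<close> coordinates on either
    side, dual to the elementary matrices with entry 1; the common modulus is
    \<open>m1\<close>.\<close>
  interpret kunneth "UT n (RDirProd ?R1 ?R2)" "UT n ?R1" "UT n ?R2"
    "\<lambda>A i j. fst (A i j)" "\<lambda>A i j. snd (A i j)" "\<lambda>A B i j. (A i j, B i j)"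
    m1 "n - 1" "n - 1" ?\<alpha> ?\<alpha> "\<lambda>i. elem_mat n ?R1 i (Suc i) 1" "\<lambda>i. elem_mat n ?R2 i (Suc i) 1"
    apply unfold_locales
    subgoal using m by simp
    subgoal by (intro UT_residue_superdiagonal_mult m) auto
    subgoal
      \<comment> \<open>The coordinates of the second group are additive modulo \<open>m2\<close>,
        hence modulo its divisor \<open>m1\<close>.\<close>
      by (rule cong_dvd_modulus[of _ _ "int m2"], intro UT_residue_superdiagonal_mult m)
        (use assms in auto)
    subgoal using one by (auto intro!: R1.elem_mat_closed)
    subgoal using one by (auto intro!: R2.elem_mat_closed)
    subgoal by (auto simp: elem_mat_def R1.res_zero_eq)
    subgoal by (auto simp: elem_mat_def R2.res_zero_eq)
    subgoal premises prems for B \<phi> i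
      using hom_UT_elem_torsion[OF m(1), where B = B and \<phi> = \<phi>, OF prems(1,2), of i "Suc i"] prems(3) by simp
    subgoal premises prems for B \<phi> x
      using hom_UT_superdiagonal[OF m(1), where B = B and \<phi> = \<phi>, OF prems] .
    subgoal premises prems for B \<phi> x
      using hom_UT_superdiagonal[OF m(2), where B = B and \<phi> = \<phi>, OF prems] .
    done
  show ?thesis using schur_multiplier_product by (simp add: power2_eq_square)
qed

end
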